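(* Let $\mathsf{N},\mathsf{T},\mathsf{M}$ be positive integers with $(\mathsf{M}-1)\mathsf{T}+1\le \mathsf{N}\le \mathsf{M}\mathsf{T}$, and let $\eta>0$. For any $\epsilon>0$ and $\xi>0$ there exists a coding scheme $\mathcal{C}(\mathsf{N},\mathsf{T},\mathsf{M},\eta)$ that satisfies $\mathsf{T}$-node $\epsilon$-DP and has $$\mathtt{LMSE}(\mathcal{C})\le \frac{\eta^{\mathsf{M}}}{\left(1+\mathtt{SNR}^*(\epsilon)\right)^{\mathsf{M}}}+\xi.$$
   Context: Setting (distributed secure multiplication). There are $\mathsf{N}$ nodes and $\mathsf{M}$ real-valued inputs $A_1,\dots,A_{\mathsf{M}}$, which are mutually independent, have zero mean, and satisfy $\mathrm{Var}(A_i)\le\eta$. A coding scheme $\mathcal{C}(\mathsf{N},\mathsf{T},\mathsf{M},\eta)$ consists of (i) a joint distribution of real zero-mean noise variables $\{\tilde R_i^{(j)}\}_{i\in[\mathsf{M}],j\in[\mathsf{N}]}$, independent of the inputs, such that the families $\{\tilde R_1^{(j)}\}_{j},\dots,\{\tilde R_{\mathsf{M}}^{(j)}\}_{j}$ are mutually independent; and (ii) real decoding coefficients $d_1,\dots,d_{\mathsf{N}}$ (which may be chosen knowing the noise distribution and $\mathsf{N},\mathsf{T},\mathsf{M},\eta$). Node $j$ stores $\tilde A_i^{(j)}=A_i+\tilde R_i^{(j)}$ for $i\in[\mathsf{M}]$ and outputs $\tilde V^{(j)}=\prod_{i=1}^{\mathsf{M}}(A_i+\tilde R_i^{(j)})$;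 the decoder outputs $\tilde V=\sum_{j=1}^{\mathsf{N}} d_j\tilde V^{(j)}$. $\mathsf{T}$-node $\epsilon$-DP: for each $i\in[\mathsf{M}]$, all $a_0,a_1\in\mathbb{R}$ with $|a_0-a_1|\le1$, every $\mathcal{T}=\{t_1,\dots,t_{\mathsf{T}}\}\subseteq[\mathsf{N}]$ with $|\mathcal{T}|=\mathsf{T}$ and every Borel set $\mathcal{B}\subseteq\mathbb{R}^{\mathsf{T}}$, $\mathbb{P}\big((a_0+\tilde R_i^{(t_1)},\dots,a_0+\tilde R_i^{(t_{\mathsf{T}})})\in\mathcal{B}\big)\le e^{\epsilon}\,\mathbb{P}\big((a_1+\tilde R_i^{(t_1)},\dots,a_1+\tilde R_i^{(t_{\mathsf{T}})})\in\mathcal{B}\big)$. $\mathtt{LMSE}(\mathcal{C})=\sup \mathbb{E}\big[|\tilde V-\prod_{i=1}^{\mathsf{M}}A_i|^2\big]$, the supremum over all joint laws of $(A_1,\dots,A_{\mathsf{M}})$ with mutually independent zero-mean components of variance at most $\eta$; expectation over inputs and noise. Notation: $\mathtt{SNR}^*(\epsilon)=\eta/\sigma^*(\epsilon)^2$, where $\sigma^*(\epsilon)^2=\dfrac{2^{2/3}e^{-2\epsilon/3}(1+e^{-2\epsilon/3})+e^{-\epsilon}}{(1-e^{-\epsilon})^2}$. *)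

theory Defs
  imports "HOL-Probability.Probability"
begin

text \<open>Indices are 0-based: inputs i < M, nodes j < N.\<close>

definition is_input_law :: "real \<Rightarrow> real measure \<Rightarrow> bool" where
  "is_input_law \<eta> \<nu> \<longleftrightarrow> prob_space \<nu> \<and> sets \<nu> = sets (borel :: real measure) \<and>
     integrable \<nu> (\<lambda>x. x) \<and> integrable \<nu> (\<lambda>x. x^2) \<and>
     (\<integral>x. x \<partial>\<nu>) = 0 \<and> (\<integral>x. (x - (\<integral>y. y \<partial>\<nu>))^2 \<partial>\<nu>) \<le> \<eta>"

text \<open>Joint law of the noise family (R_i^(j))_{j<N} for one fixed i: zero-mean components.\<close>
definition is_noise_law :: "nat \<Rightarrow> (nat \<Rightarrow> real) measure \<Rightarrow> bool" where
  "is_noise_law N \<mu> \<longleftrightarrow> prob_space \<mu> \<and> sets \<mu> = sets (PiM {..<N} (\<lambda>_. borel :: real measure)) \<and>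
     (\<forall>j<N. integrable \<mu> (\<lambda>r. r j) \<and> (\<integral>r. r j \<partial>\<mu>) = 0)"

definition node_DP :: "nat \<Rightarrow> nat \<Rightarrow> real \<Rightarrow> (nat \<Rightarrow> real) measure \<Rightarrow> bool" where
  "node_DP N T \<epsilon> \<mu> \<longleftrightarrow>
     (\<forall>S a0 a1 B. S \<subseteq> {..<N} \<and> card S = T \<and> \<bar>a0 - a1\<bar> \<le> 1 \<and>
        B \<in> sets (PiM S (\<lambda>_. borel :: real measure)) \<longrightarrow>
        measure \<mu> {r \<in> space \<mu>. (\<lambda>j\<in>S. a0 + r j) \<in> B}
          \<le> exp \<epsilon> * measure \<mu> {r \<in> space \<mu>. (\<lambda>j\<in>S. a1 + r j) \<in> B})"

text \<open>Squared error; \<omega> i = (A_i, (R_i^(j))_j).\<close>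
definition scheme_err :: "nat \<Rightarrow> nat \<Rightarrow> (nat \<Rightarrow> real) \<Rightarrow> (nat \<Rightarrow> real \<times> (nat \<Rightarrow> real)) \<Rightarrow> real" where
  "scheme_err N M d \<omega> =
     \<bar>(\<Sum>j<N. d j * (\<Prod>i<M. fst (\<omega> i) + snd (\<omega> i) j)) - (\<Prod>i<M. fst (\<omega> i))\<bar>^2"

definition LMSE :: "nat \<Rightarrow> nat \<Rightarrow> real \<Rightarrow> (nat \<Rightarrow> (nat \<Rightarrow> real) measure) \<Rightarrow> (nat \<Rightarrow> real) \<Rightarrow> ennreal" where
  "LMSE N M \<eta> \<mu> d =
     (SUP \<nu> \<in> {\<nu>. \<forall>i<M. is_input_law \<eta> (\<nu> i)}.
        \<integral>\<^sup>+ \<omega>. ennreal (scheme_err N M d \<omega>) \<partial>(PiM {..<M} (\<lambda>i. \<nu> i \<Otimes>\<^sub>M \<mu> i)))"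

definition sigma_star_sq :: "real \<Rightarrow> real" where
  "sigma_star_sq \<epsilon> =
     (2 powr (2/3) * exp (-2*\<epsilon>/3) * (1 + exp (-2*\<epsilon>/3)) + exp (-\<epsilon>)) / (1 - exp (-\<epsilon>))^2"

definition SNR_star :: "real \<Rightarrow> real \<Rightarrow> real" where
  "SNR_star \<eta> \<epsilon> = \<eta> / sigma_star_sq \<epsilon>"

end

theory Submission
  imports Defs "HOL-Computational_Algebra.Polynomial"
begin

text \<open>
  For every input \<open>A\<^sub>i\<close> draw a main noise \<open>R\<close> and auxiliary noises \<open>S\<^sub>1, \<dots>, S\<^bsub>T-1\<^esub>\<close>. With distinct
  \<open>z\<^sub>j < 0\<close> and small \<open>\<delta>\<close>, node \<open>j\<close> stores the value at \<open>z = z\<^sub>j\<close> of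
  \<open>A + R + \<delta>\<^sup>T (S\<^sub>1 z + \<dots> + S\<^bsub>T-1\<^esub> z\<^bsup>T-1\<^esup>) - \<delta>\<^bsup>T+1\<^esup> R z\<^sup>T\<close>.

  Privacy: on any \<open>T\<close> nodes a shift of \<open>A\<close> by \<open>a\<close> has the same effect as a shift of \<open>R\<close> by less than
  \<open>a\<close> and of each \<open>S\<^sub>t\<close> by \<open>O(\<delta> a)\<close>, so almost the whole privacy budget can be spent on \<open>R\<close>, which has a
  staircase density.

  Accuracy: the node outputs are values of a polynomial in \<open>z\<close>, and \<open>(M - 1) T + 1\<close> of them determine
  its coefficients of order \<open>0, T, \<dots>, (M - 1) T\<close> up to higher terms. After rescaling by powers of
  \<open>\<delta>\<^bsup>T+1\<^esup>\<close> the auxiliary noises contribute to these only at a vanishing order, since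
  \<open>(T + 1) t < T \<sqdot> T\<close> for \<open>0 < t < T\<close>. Hence all coefficients but the last of
  \<open>\<Prod>(A\<^sub>i + R\<^sub>i - R\<^sub>i y)\<close> in \<open>y\<close> are available in the limit, and these suffice to compute
  \<open>\<Prod>A\<^sub>i - \<Prod>(A\<^sub>i - \<alpha> (A\<^sub>i + R\<^sub>i))\<close>. For \<open>\<alpha> = \<eta> / (\<eta> + \<sigma>\<^sup>2)\<close> the error is the product of
  the errors of the Wiener estimates of the individual inputs.
\<close>

section \<open>Staircase noise\<close>

text \<open>
  The usual staircase density with step width 1 and ratio \<open>b\<close>, written (up to normalisation) as a
  superposition of uniform densities: moving the argument by at most 1 moves it at most one level up.
\<close>
definition staircase :: "real \<Rightarrow> real \<Rightarrow> real \<Rightarrow> ennreal" where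
  "staircase b w x = (\<Sum>k. ennreal (b ^ k) * indicator {-(w + real k)..w + real k} x)"

lemma staircase_measurable [measurable]: "staircase b w \<in> borel_measurable borel"
  unfolding staircase_def[abs_def] by measurable

lemma staircase_minus: "staircase b w (- x) = staircase b w x"
  unfolding staircase_def by (intro suminf_cong arg_cong2[where f="(*)"]) (auto simp: indicator_def)

section \<open>Shifts and moments of the staircase density\<close>

lemma suminf_Suc_le: "(\<Sum>k. f (Suc k)) \<le> (\<Sum>k. f k)" for f :: "nat \<Rightarrow> ennreal"
proof (rule suminf_le_const[OF summableI])
  fix n
  have "(\<Sum>k<n. f (Suc k)) \<le> (\<Sum>k<Suc n. f k)"
    unfolding sum.lessThan_Suc_shift by (simp add: add_increasing)
  also have "\<dots> \<le> (\<Sum>k. f k)"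
    by (rule sum_le_suminf[OF summableI]) auto
  finally show "(\<Sum>k<n. f (Suc k)) \<le> (\<Sum>k. f k)" .
qed

text \<open>If \<open>x\<close> lies in the interval of level \<open>k\<close>, then
  \<open>y\<close> lies in that of level \<open>k + 1\<close>, whose weight is smaller by the factor
  \<open>b\<close>. The series are compared term by term, and then the missing level 0 is
  added.\<close>

lemma staircase_shift_le:
  assumes "0 < b" "\<bar>x - y\<bar> \<le> 1"
  shows "staircase b w x \<le> ennreal (1 / b) * staircase b w y"
proof -
  have "staircase b w x \<le> (\<Sum>k. ennreal (1 / b) *
      (ennreal (b ^ Suc k) * indicator {-(w + real (Suc k))..w + real (Suc k)} y))"
    unfolding staircase_def
  proof (intro suminf_le summableI)
    fix k
    have "ennreal (1 / b) * (ennreal (b ^ Suc k) * indicator {-(w + real (Suc k))..w + real (Suc k)} y)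
       = ennreal (b ^ k) * indicator {-(w + real (Suc k))..w + real (Suc k)} y"
      using assms(1) by (simp add: mult.assoc[symmetric] ennreal_mult[symmetric])
    moreover have "(indicator {-(w + real k)..w + real k} x :: ennreal)
        \<le> indicator {-(w + real (Suc k))..w + real (Suc k)} y"
      using assms(2) by (auto simp: indicator_def)
    ultimately show "ennreal (b ^ k) * indicator {-(w + real k)..w + real k} x
        \<le> ennreal (1 / b) * (ennreal (b ^ Suc k) * indicator {-(w + real (Suc k))..w + real (Suc k)} y)"
      by (simp add: mult_left_mono)
  qed
  also have "\<dots> = ennreal (1 / b) *
      (\<Sum>k. ennreal (b ^ Suc k) * indicator {-(w + real (Suc k))..w + real (Suc k)} y)"
    by (simp add: ennreal_suminf_cmult)
  also have "\<dots> \<le> ennreal (1 / b) * staircase b w y"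
    unfolding staircase_def
    by (intro mult_left_mono suminf_Suc_le) simp
  finally show ?thesis .
qed

text \<open>For a geometric variable K with weights \<open>(1 - b) * b ^ k\<close>, these are the
  first and third moments of w + K, divided by \<open>1 - b\<close>. The mean is \<open>s\<close>,
  while \<open>b / (1 - b)\<^sup>2\<close> and \<open>b * (1 + b) / (1 - b) ^ 3\<close> are the
  variance and the third central moment. Both series telescope.\<close>

lemma weighted_geometric_sums:
  fixes b w :: real
  assumes b: "0 < b" "b < 1"
  defines "s \<equiv> w + b / (1 - b)"
  shows "(\<lambda>k. b ^ k * (w + real k)) sums (s / (1 - b))" (is ?A)
    and "(\<lambda>k. b ^ k * (w + real k) ^ 3) sums
      ((s ^ 3 + 3 * s * (b / (1 - b)\<^sup>2) + b * (1 + b) / (1 - b) ^ 3) / (1 - b))" (is ?B)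
proof -
  have lim: "(\<lambda>k. b ^ k * real k ^ m) \<longlonglongrightarrow> 0" for m
  proof (cases "m = 0")
    case True
    then show ?thesis using b by (simp add: LIMSEQ_realpow_zero)
  next
    case False
    \<comment> \<open>Taking the \<open>m\<close>-th root of \<open>b\<close> reduces the claim to
      the first power of \<open>k\<close>.\<close>
    have "(\<lambda>k. (real k * root m b ^ k) ^ m) \<longlonglongrightarrow> 0 ^ m"
      using False b by (intro tendsto_power powser_times_n_limit_0) simp
    moreover have "(real k * root m b ^ k) ^ m = b ^ k * real k ^ m" for k
    proof -
      have "(root m b ^ k) ^ m = (root m b ^ m) ^ k"
        by (simp only: power_mult[symmetric] mult.commute)
      then show ?thesis
        using False b by (simp add: power_mult_distrib)
    qed
    ultimately show ?thesis using False by (simp add: zero_power)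
  qed
  \<comment> \<open>These are the tails of the series in closed form, so their consecutive
    differences are its terms.\<close>
  have "(\<lambda>k. b ^ k * ((s + real k) / (1 - b))) \<longlonglongrightarrow> 0"
  proof -
    have "(\<lambda>k. (s * (b ^ k * real k ^ 0) + b ^ k * real k ^ 1) / (1 - b)) \<longlonglongrightarrow> (s * 0 + 0) / (1 - b)"
      by (intro tendsto_intros lim) (use b in auto)
    thus ?thesis by (simp add: algebra_simps)
  qed
  from telescope_sums'[OF this] have "(\<lambda>k. b ^ k * ((s + real k) / (1 - b)) - b ^ Suc k * ((s + real (Suc k)) / (1 - b)))
     sums (s / (1 - b))" by simp
  moreover have "b ^ k * ((s + real k) / (1 - b)) - b ^ Suc k * ((s + real (Suc k)) / (1 - b)) = b ^ k * (w + real k)" for k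
  proof -
    have "(s + real k) / (1 - b) - b * ((s + real (Suc k)) / (1 - b)) = w + real k"
      using b unfolding s_def by (simp add: divide_simps) (simp add: algebra_simps)
    from arg_cong[OF this, of "\<lambda>x. b ^ k * x"] show ?thesis by (simp add: algebra_simps)
  qed
  ultimately show ?A by simp
  define v where "v = b / (1 - b)\<^sup>2"
  define c where "c = b * (1 + b) / (1 - b) ^ 3"
  \<comment> \<open>\<open>P x\<close> is the closed form of the sum of b^m (x + m)^3 over all m.
    Hence \<open>P x - b * P (x + 1) = x ^ 3\<close>, and \<open>b ^ k * P (w + real k)\<close> is
    again a tail.\<close>
  define P where "P = (\<lambda>x::real. ((x + b / (1 - b)) ^ 3 + 3 * (x + b / (1 - b)) * v + c) / (1 - b))"
  have "(\<lambda>k. b ^ k * P (w + real k)) \<longlonglongrightarrow> 0"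
  proof -
    have "(\<lambda>k. ((s ^ 3 + 3 * s * v + c) * (b ^ k * real k ^ 0) + (3 * s ^ 2 + 3 * v) * (b ^ k * real k ^ 1)
       + 3 * s * (b ^ k * real k ^ 2) + b ^ k * real k ^ 3) / (1 - b))
      \<longlonglongrightarrow> ((s ^ 3 + 3 * s * v + c) * 0 + (3 * s ^ 2 + 3 * v) * 0 + 3 * s * 0 + 0) / (1 - b)"
      by (intro tendsto_intros lim) (use b in auto)
    moreover have "((s ^ 3 + 3 * s * v + c) * (b ^ k * real k ^ 0) + (3 * s ^ 2 + 3 * v) * (b ^ k * real k ^ 1)
       + 3 * s * (b ^ k * real k ^ 2) + b ^ k * real k ^ 3) / (1 - b) = b ^ k * P (w + real k)" for k
    proof -
      have eq: "w + real k + b / (1 - b) = s + real k" by (simp add: s_def)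
      show ?thesis unfolding P_def times_divide_eq_right eq
        by (intro arg_cong2[where f="(/)"]) (simp_all add: power3_eq_cube power2_eq_square algebra_simps)
    qed
    ultimately show ?thesis by simp
  qed
  from telescope_sums'[OF this] have "(\<lambda>k. b ^ k * P (w + real k) - b ^ Suc k * P (w + real (Suc k)))
     sums P w" by simp
  moreover have "b ^ k * P (w + real k) - b ^ Suc k * P (w + real (Suc k)) = b ^ k * (w + real k) ^ 3" for k
  proof -
    define x where "x = w + real k"
    \<comment> \<open>The substitution removes all denominators: with
      \<open>1 / (1 - b) = 1 + q\<close> and \<open>b * (1 + q) = q\<close> the difference equation
      for \<open>P\<close> becomes a polynomial identity in \<open>x\<close> and
      \<open>q\<close>.\<close>
    define q where "q = b / (1 - b)"
    define G where "G = (\<lambda>x. (x + q) ^ 3 + 3 * (x + q) * (q * (1 + q)) + q * (1 + q) * (1 + 2 * q))"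
    have q: "1 / (1 - b) = 1 + q" "b / (1 - b) = q"
      using b by (auto simp: q_def field_simps)
    have "v = b / (1 - b) * (1 / (1 - b))"
      by (simp add: v_def power2_eq_square)
    then have v: "v = q * (1 + q)" by (simp only: q)
    have "c = b / (1 - b) * (1 / (1 - b)) * (1 / (1 - b) + b / (1 - b))"
      by (simp add: c_def power3_eq_cube add_divide_distrib[symmetric] mult_ac)
    then have c: "c = q * (1 + q) * (1 + 2 * q)" by (simp only: q) simp
    have P: "P x = (1 + q) * G x" for x
    proof -
      have "P x = (1 / (1 - b)) * G x"
        unfolding P_def G_def v c q(2) by simp
      then show ?thesis by (simp only: q(1))
    qed
    have "b * (1 + q) = q" unfolding q(1)[symmetric] by (simp add: q_def)
    then have "P x - b * P (x + 1) = (1 + q) * G x - q * G (x + 1)"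
      by (simp add: P mult.assoc[symmetric])
    also have "\<dots> = x ^ 3"
      unfolding G_def by (simp add: power3_eq_cube algebra_simps)
    finally have "P x - b * P (x + 1) = x ^ 3" .
    from arg_cong[OF this, of "\<lambda>x. b ^ k * x"] show ?thesis by (simp add: algebra_simps x_def)
  qed
  ultimately show ?B by (simp add: P_def v_def c_def s_def)
qed


text \<open>Integration proceeds level by level: an interval of half-width h has length 2 h and
  second moment 2 h^3 / 3, which leads to the two weighted geometric series.\<close>

lemma nn_integral_staircase:
  assumes b: "0 < b" "b < 1" and w: "0 \<le> w"
  defines "s \<equiv> w + b / (1 - b)"
  shows "(\<integral>\<^sup>+x. staircase b w x \<partial>lborel) = ennreal (2 * s / (1 - b))"
    and "(\<integral>\<^sup>+x. ennreal (x\<^sup>2) * staircase b w x \<partial>lborel) =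
      ennreal (2 / 3 * (s ^ 3 + 3 * s * (b / (1 - b)\<^sup>2) + b * (1 + b) / (1 - b) ^ 3) / (1 - b))"
proof -
  have "(\<integral>\<^sup>+x. staircase b w x \<partial>lborel)
      = (\<Sum>k. \<integral>\<^sup>+x. ennreal (b ^ k) * indicator {-(w + real k)..w + real k} x \<partial>lborel)"
    unfolding staircase_def by (subst nn_integral_suminf) auto
  also have "\<dots> = (\<Sum>k. ennreal (2 * (b ^ k * (w + real k))))"
  proof (intro suminf_cong)
    fix k
    have "(\<integral>\<^sup>+x. ennreal (b ^ k) * indicator {-(w + real k)..w + real k} x \<partial>lborel)
       = ennreal (b ^ k) * ennreal (2 * (w + real k))"
      using w by (subst nn_integral_cmult_indicator) auto
    also have "\<dots> = ennreal (b ^ k * (2 * (w + real k)))"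
      using b w by (intro ennreal_mult[symmetric]) auto
    finally show "(\<integral>\<^sup>+x. ennreal (b ^ k) * indicator {-(w + real k)..w + real k} x \<partial>lborel)
       = ennreal (2 * (b ^ k * (w + real k)))"
      by (simp only: mult_ac)
  qed
  also have "\<dots> = ennreal (2 * (s / (1 - b)))"
    using b w sums_mult[OF weighted_geometric_sums(1)[OF b, of w], of 2]
    by (intro suminf_ennreal_eq) (auto simp: s_def)
  finally show "(\<integral>\<^sup>+x. staircase b w x \<partial>lborel) = ennreal (2 * s / (1 - b))" by simp
  have "(\<integral>\<^sup>+x. ennreal (x\<^sup>2) * staircase b w x \<partial>lborel)
      = (\<integral>\<^sup>+x. (\<Sum>k. ennreal (b ^ k) * (ennreal (x\<^sup>2) * indicator {-(w + real k)..w + real k} x)) \<partial>lborel)"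
    unfolding staircase_def by (simp add: ennreal_suminf_cmult[symmetric] mult_ac del: ennreal_suminf_cmult)
  also have "\<dots> = (\<Sum>k. \<integral>\<^sup>+x. ennreal (b ^ k) * (ennreal (x\<^sup>2) * indicator {-(w + real k)..w + real k} x) \<partial>lborel)"
    by (subst nn_integral_suminf) auto
  also have "\<dots> = (\<Sum>k. ennreal (2 / 3 * (b ^ k * (w + real k) ^ 3)))"
  proof (intro suminf_cong)
    fix k
    define c where "c = w + real k"
    have c: "0 \<le> c" using w by (simp add: c_def)
    have "((\<lambda>x. x\<^sup>2) has_integral (c ^ 3 / 3 - (-c) ^ 3 / 3)) {-c..c}"
      using c by (intro fundamental_theorem_of_calculus)
        (auto intro!: derivative_eq_intros simp: has_real_derivative_iff_has_vector_derivative[symmetric])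
    from nn_integral_has_integral_lebesgue'[OF _ this]
    have "(\<integral>\<^sup>+x. ennreal (x\<^sup>2) * indicator {-c..c} x \<partial>lborel) = ennreal (2 / 3 * c ^ 3)"
      by simp
    then have "(\<integral>\<^sup>+x. ennreal (b ^ k) * (ennreal (x\<^sup>2) * indicator {-c..c} x) \<partial>lborel)
       = ennreal (b ^ k) * ennreal (2 / 3 * c ^ 3)"
      by (subst nn_integral_cmult) auto
    then show "(\<integral>\<^sup>+x. ennreal (b ^ k) * (ennreal (x\<^sup>2) * indicator {-(w + real k)..w + real k} x) \<partial>lborel)
       = ennreal (2 / 3 * (b ^ k * (w + real k) ^ 3))"
      using b c by (simp add: ennreal_mult[symmetric] mult_ac c_def)
  qed
  also have "\<dots> = ennreal (2 / 3 * ((s ^ 3 + 3 * s * (b / (1 - b)\<^sup>2) + b * (1 + b) / (1 - b) ^ 3) / (1 - b)))"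
    using b w sums_mult[OF weighted_geometric_sums(2)[OF b, of w], of "2/3"]
    by (intro suminf_ennreal_eq) (auto simp: s_def)
  finally show "(\<integral>\<^sup>+x. ennreal (x\<^sup>2) * staircase b w x \<partial>lborel) =
      ennreal (2 / 3 * (s ^ 3 + 3 * s * (b / (1 - b)\<^sup>2) + b * (1 + b) / (1 - b) ^ 3) / (1 - b))"
    by simp
qed

text \<open>Privacy of additive noise, stated for nonnegative functions instead of events so that it
  can be used under an integral sign, one coordinate at a time.\<close>

definition shift_DP :: "real \<Rightarrow> real measure \<Rightarrow> bool" where
  "shift_DP \<epsilon> \<rho> \<longleftrightarrow> (\<forall>F u v. F \<in> borel_measurable borel \<longrightarrow> \<bar>u - v\<bar> \<le> 1 \<longrightarrow>
     (\<integral>\<^sup>+x. F (x + u) \<partial>\<rho>) \<le> ennreal (exp \<epsilon>) * (\<integral>\<^sup>+x. F (x + v) \<partial>\<rho>))"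

definition dp_noise :: "real \<Rightarrow> real \<Rightarrow> real measure \<Rightarrow> bool" where
  "dp_noise \<epsilon> v \<rho> \<longleftrightarrow> prob_space \<rho> \<and> sets \<rho> = sets borel \<and> integrable \<rho> (\<lambda>x. x) \<and>
     (\<integral>x. x \<partial>\<rho>) = 0 \<and> (\<integral>\<^sup>+x. ennreal (x\<^sup>2) \<partial>\<rho>) \<le> ennreal v \<and> shift_DP \<epsilon> \<rho>"

text \<open>
  The variance for \<open>b = p\<^sup>3\<close> and \<open>w = (p - p\<^sup>3) / (1 - p\<^sup>3)\<close>. This \<open>w\<close> is not the variance minimiser,
  but it avoids a further cube root and already beats \<^const>\<open>sigma_star_sq\<close> strictly.
\<close>
definition staircase_var :: "real \<Rightarrow> real" where
  "staircase_var p = (p\<^sup>2 * (2 + p ^ 3) / 3 + p ^ 3) / (1 - p ^ 3)\<^sup>2"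

text \<open>The noise has the normalised staircase density of ratio
  \<open>exp (- \<epsilon>)\<close>, for which a unit shift costs the factor
  \<open>1 / b = exp \<epsilon>\<close>.\<close>

lemma ex_dp_noise:
  assumes "0 < \<epsilon>"
  shows "\<exists>\<rho>. dp_noise \<epsilon> (staircase_var (exp (- \<epsilon> / 3))) \<rho>"
proof -
  define p where "p = exp (- \<epsilon> / 3)"
  define b where "b = p ^ 3"
  have p: "0 < p" "p < 1" using assms by (auto simp: p_def)
  have b_exp: "b = exp (- \<epsilon>)" by (simp add: b_def p_def exp_of_nat_mult[symmetric])
  have b: "0 < b" "b < 1" using assms by (auto simp: b_exp)
  have "b \<le> p" using p power_decreasing[of 1 3 p] by (simp add: b_def)
  \<comment> \<open>\<open>b \<le> p\<close> makes \<open>w\<close> nonnegative, and the mean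
    half-width \<open>w + b / (1 - b)\<close> collapses to \<open>s\<close>.\<close>
  define w where "w = (p - b) / (1 - b)"
  define s where "s = p / (1 - b)"
  have w: "0 \<le> w" using b \<open>b \<le> p\<close> by (simp add: w_def)
  have s: "w + b / (1 - b) = s" "0 < s"
    using b p by (auto simp: w_def s_def diff_divide_distrib)
  define Z where "Z = 2 * s / (1 - b)"
  have Z: "0 < Z" using s b by (simp add: Z_def)
  define D where "D = (\<lambda>x. ennreal (1 / Z) * staircase b w x)"
  have D[measurable]: "D \<in> borel_measurable borel" unfolding D_def by measurable
  define \<rho> where "\<rho> = density lborel D"
  have sets: "sets \<rho> = sets borel" by (simp add: \<rho>_def)
  have nn: "(\<integral>\<^sup>+x. F x \<partial>\<rho>) = ennreal (1 / Z) * (\<integral>\<^sup>+x. F x * staircase b w x \<partial>lborel)"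
    if [measurable]: "F \<in> borel_measurable borel" for F
    unfolding \<rho>_def D_def
    by (subst nn_integral_density) (auto simp: nn_integral_cmult[symmetric] mult_ac)
  have "emeasure \<rho> (space \<rho>) = (\<integral>\<^sup>+x. 1 \<partial>\<rho>)" by simp
  also have "\<dots> = ennreal (1 / Z) * ennreal Z"
    using nn_integral_staircase(1)[OF b w] by (subst nn) (simp_all add: s Z_def)
  also have "\<dots> = 1" using Z by (simp add: ennreal_mult[symmetric])
  finally have "prob_space \<rho>" by (rule prob_spaceI)
  then interpret prob_space \<rho> .
  have var: "(\<integral>\<^sup>+x. ennreal (x\<^sup>2) \<partial>\<rho>) = ennreal (staircase_var p)"
  proof -
    define Q where "Q = 2 / 3 * (s ^ 3 + 3 * s * (b / (1 - b)\<^sup>2) + b * (1 + b) / (1 - b) ^ 3) / (1 - b)"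
    have "(\<integral>\<^sup>+x. ennreal (x\<^sup>2) \<partial>\<rho>) = ennreal (1 / Z) * ennreal Q"
      unfolding Q_def using nn_integral_staircase(2)[OF b w] by (simp add: nn s)
    also have "\<dots> = ennreal (1 / Z * Q)"
      using Z s b by (intro ennreal_mult[symmetric]) (auto simp: Q_def)
    also have "1 / Z * Q = staircase_var p"
    proof -
      define r where "r = 1 - b"
      have r: "r > 0" "p ^ 3 = b" "1 - b = r" using b by (auto simp: r_def b_def)
      have "1 / Z * Q = s\<^sup>2 / 3 + b / r\<^sup>2 + b * (1 + b) / (3 * s * r ^ 3)"
        using r(1) s(2) unfolding Z_def Q_def r(3) by (simp add: field_simps power2_eq_square power3_eq_cube)
      also have "\<dots> = (p\<^sup>2 / 3 + b + b * (1 + b) / (3 * p)) / r\<^sup>2"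
        using r(1) p by (simp add: s_def r(3) field_simps power2_eq_square power3_eq_cube)
      also have "b * (1 + b) / (3 * p) = p\<^sup>2 * (1 + b) / 3"
        using p by (simp add: b_def field_simps power2_eq_square power3_eq_cube)
      finally show ?thesis unfolding staircase_var_def r by (simp add: algebra_simps add_divide_distrib)
    qed
    finally show ?thesis .
  qed
  note sets[measurable_cong]
  have "integrable \<rho> (\<lambda>x. x\<^sup>2)"
    by (rule integrableI_bounded) (simp_all add: var)
  then have int: "integrable \<rho> (\<lambda>x. x)"
    by (rule square_integrable_imp_integrable[rotated]) measurable
  \<comment> \<open>Invariance under reflection equates the mean with its negative.\<close>
  have "distr \<rho> borel uminus = \<rho>"
  proof (rule measure_eqI)
    fix A assume "A \<in> sets (distr \<rho> borel uminus)"
    then have [measurable]: "A \<in> sets borel" by simp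
    have "emeasure (distr \<rho> borel uminus) A = (\<integral>\<^sup>+x. indicator A (- x) \<partial>\<rho>)"
      by (subst nn_integral_indicator[symmetric], simp, subst nn_integral_distr) simp_all
    also have "\<dots> = ennreal (1 / Z) * (\<integral>\<^sup>+x. indicator A (- x) * staircase b w x \<partial>lborel)"
      by (subst nn) auto
    also have "(\<integral>\<^sup>+x. indicator A (- x) * staircase b w x \<partial>lborel) = (\<integral>\<^sup>+x. indicator A x * staircase b w x \<partial>lborel)"
      by (subst (2) nn_integral_real_affine[where c="-1" and t=0]) (auto simp: staircase_minus)
    also have "ennreal (1 / Z) * \<dots> = (\<integral>\<^sup>+x. indicator A x \<partial>\<rho>)"
      by (subst nn) auto
    also have "\<dots> = emeasure \<rho> A"
      by (subst nn_integral_indicator) (auto simp: sets)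
    finally show "emeasure (distr \<rho> borel uminus) A = emeasure \<rho> A" .
  qed (simp add: sets)
  moreover have "(\<integral>x. x \<partial>distr \<rho> borel uminus) = (\<integral>x. - x \<partial>\<rho>)"
    by (rule integral_distr) measurable
  ultimately have mean: "(\<integral>x. x \<partial>\<rho>) = 0" by simp
  have "shift_DP \<epsilon> \<rho>"
    unfolding shift_DP_def
  proof (intro allI impI)
    fix F :: "real \<Rightarrow> ennreal" and u v :: real
    assume [measurable]: "F \<in> borel_measurable borel" and uv: "\<bar>u - v\<bar> \<le> 1"
    have shift: "(\<integral>\<^sup>+x. F (x + u) \<partial>\<rho>) = ennreal (1 / Z) * (\<integral>\<^sup>+y. F y * staircase b w (y - u) \<partial>lborel)" for u
      by (subst nn, simp, subst (2) nn_integral_real_affine[where c=1 and t=u]) (auto simp: add.commute)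
    have "(\<integral>\<^sup>+y. F y * staircase b w (y - u) \<partial>lborel)
       \<le> (\<integral>\<^sup>+y. ennreal (exp \<epsilon>) * (F y * staircase b w (y - v)) \<partial>lborel)"
    proof (intro nn_integral_mono)
      fix y
      have "staircase b w (y - u) \<le> ennreal (1 / b) * staircase b w (y - v)"
        using b uv by (intro staircase_shift_le) auto
      also have "1 / b = exp \<epsilon>" by (simp add: b_exp exp_minus field_simps)
      finally have "F y * staircase b w (y - u) \<le> F y * (ennreal (exp \<epsilon>) * staircase b w (y - v))"
        by (intro mult_left_mono) auto
      then show "F y * staircase b w (y - u) \<le> ennreal (exp \<epsilon>) * (F y * staircase b w (y - v))"
        by (simp add: mult_ac)
    qed
    then have "ennreal (1 / Z) * (\<integral>\<^sup>+y. F y * staircase b w (y - u) \<partial>lborel)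
       \<le> ennreal (1 / Z) * (ennreal (exp \<epsilon>) * (\<integral>\<^sup>+y. F y * staircase b w (y - v) \<partial>lborel))"
      by (intro mult_left_mono) (auto simp: nn_integral_cmult)
    then show "(\<integral>\<^sup>+x. F (x + u) \<partial>\<rho>) \<le> ennreal (exp \<epsilon>) * (\<integral>\<^sup>+x. F (x + v) \<partial>\<rho>)"
      unfolding shift by (simp add: mult_ac)
  qed
  then show ?thesis
    using sets int mean var \<open>prob_space \<rho>\<close> by (intro exI[of _ \<rho>]) (simp add: dp_noise_def p_def)
qed

text \<open>In terms of \<open>p\<close> both fractions have the denominator (1 - p^3)^2 and the
  summand \<open>p ^ 3\<close> in the numerator. After dividing the rest by
  \<open>p\<^sup>2\<close>, what remains is (2 + p^3) / 3 < 1 \<le> 2^(2/3) (1 + p^2).\<close>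

lemma staircase_var_less_sigma_star_sq:
  assumes "0 < \<epsilon>"
  shows "staircase_var (exp (- \<epsilon> / 3)) < sigma_star_sq \<epsilon>"
proof -
  define p where "p = exp (- \<epsilon> / 3)"
  have p: "0 < p" "p < 1" using assms by (auto simp: p_def)
  have e: "exp (-2*\<epsilon>/3) = p\<^sup>2" "exp (- \<epsilon>) = p ^ 3"
    by (simp_all add: p_def exp_of_nat_mult[symmetric])
  have "p ^ 3 < 1" using p by (simp add: power_less_one_iff)
  have "(2 + p ^ 3) / 3 < 1" using \<open>p ^ 3 < 1\<close> by simp
  also have "1 \<le> 2 powr (2/3) * (1 + p\<^sup>2)"
    using mult_mono[of 1 "2 powr (2/3)" 1 "1 + p\<^sup>2"] ge_one_powr_ge_zero[of 2 "2/3"] by simp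
  finally have "p\<^sup>2 * ((2 + p ^ 3) / 3) < p\<^sup>2 * (2 powr (2/3) * (1 + p\<^sup>2))"
    using p by (intro mult_strict_left_mono) auto
  then show ?thesis
    unfolding sigma_star_sq_def staircase_var_def p_def[symmetric] e
    using \<open>p ^ 3 < 1\<close> by (intro divide_strict_right_mono) (auto simp: mult_ac)
qed

text \<open>By continuity the strict inequality survives a slightly smaller budget; the budget saved
  in this way pays for the auxiliary noises.\<close>

lemma ex_staircase_var_less_sigma_star_sq:
  assumes "0 < \<epsilon>"
  shows "\<exists>\<epsilon>'. 0 < \<epsilon>' \<and> \<epsilon>' < \<epsilon> \<and> staircase_var (exp (- \<epsilon>' / 3)) < sigma_star_sq \<epsilon>"
proof -
  have "exp (- \<epsilon> / 3) ^ 3 \<noteq> 1"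
    using assms by (simp add: exp_of_nat_mult[symmetric])
  then have "((\<lambda>x. staircase_var (exp (- x / 3))) \<longlongrightarrow> staircase_var (exp (- \<epsilon> / 3))) (at_left \<epsilon>)"
    unfolding staircase_var_def by (intro tendsto_intros) auto
  then have "\<forall>\<^sub>F x in at_left \<epsilon>. staircase_var (exp (- x / 3)) < sigma_star_sq \<epsilon>"
    using staircase_var_less_sigma_star_sq[OF assms] by (rule order_tendstoD)
  moreover have "\<forall>\<^sub>F x in at_left \<epsilon>. x \<in> {0<..<\<epsilon>}"
    using assms by (rule eventually_at_leftI[rotated]) auto
  ultimately have "\<forall>\<^sub>F x in at_left \<epsilon>. 0 < x \<and> x < \<epsilon> \<and> staircase_var (exp (- x / 3)) < sigma_star_sq \<epsilon>"
    by eventually_elim auto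
  then show ?thesis
    by (rule eventually_happens'[rotated]) simp
qed

text \<open>Composition for independent noises: the coordinates are shifted one after the other,
  each at the cost of its own factor \<open>exp (e i)\<close>.\<close>

lemma nn_integral_PiM_shift_le:
  fixes \<rho> :: "'i \<Rightarrow> real measure" and u v :: "'i \<Rightarrow> real"
  assumes "finite I"
    and prob: "\<And>i. prob_space (\<rho> i)" and sets: "\<And>i. sets (\<rho> i) = sets borel"
    and DP: "\<And>i. shift_DP (e i) (\<rho> i)"
    and uv: "\<And>i. i \<in> I \<Longrightarrow> \<bar>u i - v i\<bar> \<le> 1"
    and F: "F \<in> borel_measurable (PiM I (\<lambda>_. borel))"
  shows "(\<integral>\<^sup>+g. F (\<lambda>i\<in>I. g i + u i) \<partial>PiM I \<rho>)
    \<le> ennreal (exp (\<Sum>i\<in>I. e i)) * (\<integral>\<^sup>+g. F (\<lambda>i\<in>I. g i + v i) \<partial>PiM I \<rho>)"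
  using \<open>finite I\<close> uv F
proof (induction I arbitrary: F rule: finite_induct)
  case empty
  then show ?case by simp
next
  case (insert i I)
  interpret product_prob_space \<rho>
    by (rule product_prob_spaceI) (rule prob)
  interpret PI: prob_space "PiM I \<rho>"
    by (intro prob_space_PiM prob)
  note sets[measurable_cong] insert.prems(2)[measurable]
  have [simp]: "finite I" "i \<notin> I" using insert by auto
  have setsP[measurable_cong]: "sets (PiM J \<rho>) = sets (PiM J (\<lambda>_. borel))" for J
    by (intro sets_PiM_cong) (auto simp: sets)
  have upd: "(\<lambda>k\<in>insert i I. (x(i := y)) k + c k) = (\<lambda>k\<in>I. x k + c k)(i := y + c i)" for x y and c :: "'i \<Rightarrow> real"
    by (auto simp: fun_eq_iff)
  have upd': "(\<lambda>k\<in>I. x k + (c(i := d)) k) = (\<lambda>k\<in>I. x k + c k)" for x and c :: "'i \<Rightarrow> real" and d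
    by (auto simp: fun_eq_iff)
  have meas[measurable]: "(\<lambda>g. F (\<lambda>k\<in>insert i I. g k + c k)) \<in> borel_measurable (PiM (insert i I) \<rho>)" for c
    by measurable
  have [measurable]: "(\<lambda>h. h(i := c)) \<in> PiM I (\<lambda>_. borel) \<rightarrow>\<^sub>M PiM (insert i I) (\<lambda>_. borel)" for c :: real
    by measurable
  have "(\<integral>\<^sup>+g. F (\<lambda>k\<in>insert i I. g k + u k) \<partial>PiM (insert i I) \<rho>)
     = (\<integral>\<^sup>+x. (\<integral>\<^sup>+y. F ((\<lambda>k\<in>I. x k + u k)(i := y + u i)) \<partial>\<rho> i) \<partial>PiM I \<rho>)"
    by (subst product_nn_integral_insert[OF _ _ meas]) (simp_all only: upd \<open>finite I\<close> \<open>i \<notin> I\<close> not_False_eq_True)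
  also have "\<dots> \<le> (\<integral>\<^sup>+x. ennreal (exp (e i)) * (\<integral>\<^sup>+y. F ((\<lambda>k\<in>I. x k + u k)(i := y + v i)) \<partial>\<rho> i) \<partial>PiM I \<rho>)"
  proof (intro nn_integral_mono)
    fix x
    have "(\<lambda>k\<in>I. x k + u k) \<in> space (PiM I (\<lambda>_. borel))" by (simp add: space_PiM)
    then have "(\<lambda>y. F ((\<lambda>k\<in>I. x k + u k)(i := y))) \<in> borel_measurable borel"
      by measurable
    then show "(\<integral>\<^sup>+y. F ((\<lambda>k\<in>I. x k + u k)(i := y + u i)) \<partial>\<rho> i)
       \<le> ennreal (exp (e i)) * (\<integral>\<^sup>+y. F ((\<lambda>k\<in>I. x k + u k)(i := y + v i)) \<partial>\<rho> i)"
      using DP[of i] insert.prems(1)[of i] unfolding shift_DP_def by blast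
  qed
  also have "\<dots> = ennreal (exp (e i)) * (\<integral>\<^sup>+x. (\<integral>\<^sup>+y. F ((\<lambda>k\<in>I. x k + u k)(i := y + v i)) \<partial>\<rho> i) \<partial>PiM I \<rho>)"
    by (rule nn_integral_cmult) measurable
  finally have first: "(\<integral>\<^sup>+g. F (\<lambda>k\<in>insert i I. g k + u k) \<partial>PiM (insert i I) \<rho>)
     \<le> ennreal (exp (e i)) * (\<integral>\<^sup>+x. (\<integral>\<^sup>+y. F ((\<lambda>k\<in>I. x k + u k)(i := y + v i)) \<partial>\<rho> i) \<partial>PiM I \<rho>)" .
  \<comment> \<open>Now coordinate \<open>i\<close> is shifted by \<open>v i\<close> and the others
    still by \<open>u\<close>. Passing through the joint integral exchanges the order of
    integration, so the induction hypothesis applies for each fixed value of coordinate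
    \<open>i\<close>.\<close>
  have "(\<integral>\<^sup>+x. (\<integral>\<^sup>+y. F ((\<lambda>k\<in>I. x k + u k)(i := y + v i)) \<partial>\<rho> i) \<partial>PiM I \<rho>)
     = (\<integral>\<^sup>+g. F (\<lambda>k\<in>insert i I. g k + (u(i := v i)) k) \<partial>PiM (insert i I) \<rho>)"
    by (subst product_nn_integral_insert[OF _ _ meas])
      (simp_all only: upd upd' fun_upd_same \<open>finite I\<close> \<open>i \<notin> I\<close> not_False_eq_True)
  also have "\<dots> = (\<integral>\<^sup>+y. (\<integral>\<^sup>+x. F ((\<lambda>k\<in>I. x k + u k)(i := y + v i)) \<partial>PiM I \<rho>) \<partial>\<rho> i)"
    by (subst product_nn_integral_insert_rev[OF _ _ meas])
      (simp_all only: upd upd' fun_upd_same \<open>finite I\<close> \<open>i \<notin> I\<close> not_False_eq_True)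
  also have "\<dots> \<le> (\<integral>\<^sup>+y. ennreal (exp (\<Sum>i\<in>I. e i)) *
      (\<integral>\<^sup>+x. F ((\<lambda>k\<in>I. x k + v k)(i := y + v i)) \<partial>PiM I \<rho>) \<partial>\<rho> i)"
  proof (intro nn_integral_mono insert.IH)
    fix y
    show "(\<lambda>h. F (h(i := y + v i))) \<in> borel_measurable (PiM I (\<lambda>_. borel))"
      by measurable
  qed (use insert.prems(1) in blast)
  also have "\<dots> = ennreal (exp (\<Sum>i\<in>I. e i)) *
      (\<integral>\<^sup>+y. (\<integral>\<^sup>+x. F ((\<lambda>k\<in>I. x k + v k)(i := y + v i)) \<partial>PiM I \<rho>) \<partial>\<rho> i)"
    by (rule nn_integral_cmult) measurable
  also have "(\<integral>\<^sup>+y. (\<integral>\<^sup>+x. F ((\<lambda>k\<in>I. x k + v k)(i := y + v i)) \<partial>PiM I \<rho>) \<partial>\<rho> i)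
     = (\<integral>\<^sup>+g. F (\<lambda>k\<in>insert i I. g k + v k) \<partial>PiM (insert i I) \<rho>)"
    by (subst product_nn_integral_insert_rev[OF _ _ meas]) (simp_all only: upd \<open>finite I\<close> \<open>i \<notin> I\<close> not_False_eq_True)
  finally have "ennreal (exp (e i)) * (\<integral>\<^sup>+x. (\<integral>\<^sup>+y. F ((\<lambda>k\<in>I. x k + u k)(i := y + v i)) \<partial>\<rho> i) \<partial>PiM I \<rho>)
     \<le> ennreal (exp (e i)) * (ennreal (exp (\<Sum>i\<in>I. e i)) *
       (\<integral>\<^sup>+g. F (\<lambda>k\<in>insert i I. g k + v k) \<partial>PiM (insert i I) \<rho>))"
    by (rule mult_left_mono) simp
  also have "\<dots> = ennreal (exp (\<Sum>i\<in>insert i I. e i)) *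
       (\<integral>\<^sup>+g. F (\<lambda>k\<in>insert i I. g k + v k) \<partial>PiM (insert i I) \<rho>)"
    by (simp only: mult.assoc[symmetric] ennreal_mult[symmetric] exp_ge_zero exp_add[symmetric]
        sum.insert[OF \<open>finite I\<close> \<open>i \<notin> I\<close>])
  finally show ?case using first by (rule order_trans[rotated])
qed

section \<open>Layered noise and privacy\<close>

text \<open>
  The sign of the points makes the constant term of \<open>\<Prod>(z - z\<^sub>j)\<close> positive, so that in
  \<open>ex_absorbing_shift\<close> the shift of the main noise stays below 1.
\<close>
definition node_pt :: "nat \<Rightarrow> real" where
  "node_pt j = - real (Suc j)"

text \<open>
  The noises are indexed by \<open>{1..T}\<close>; index \<open>T\<close> is the main noise, the others are auxiliary.
\<close>
definition gain :: "nat \<Rightarrow> real \<Rightarrow> real \<Rightarrow> nat \<Rightarrow> real" where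
  "gain T \<delta> z t = (if t = T then 1 - \<delta> ^ (T + 1) * z ^ T else \<delta> ^ T * z ^ t)"

definition node_noise :: "nat \<Rightarrow> real \<Rightarrow> (nat \<Rightarrow> real) \<Rightarrow> nat \<Rightarrow> real" where
  "node_noise T \<delta> g j = (\<Sum>t\<in>{1..T}. gain T \<delta> (node_pt j) t * g t)"

definition noise_law :: "nat \<Rightarrow> nat \<Rightarrow> real \<Rightarrow> (nat \<Rightarrow> real measure) \<Rightarrow> (nat \<Rightarrow> real) measure" where
  "noise_law N T \<delta> \<rho> = distr (PiM {1..T} \<rho>) (PiM {..<N} (\<lambda>_. borel)) (\<lambda>g. \<lambda>j\<in>{..<N}. node_noise T \<delta> g j)"

definition node_poly :: "nat set \<Rightarrow> real poly" where
  "node_poly S = (\<Prod>j\<in>S. [:- node_pt j, 1:])"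

text \<open>
  A shift \<open>v\<close> of the noises imitates a unit shift of the input on the nodes of \<open>S\<close> iff the polynomial
  \<open>v\<^sub>T (1 - \<delta>\<^bsup>T+1\<^esup> z\<^sup>T) + \<delta>\<^sup>T \<Sum> v\<^sub>t z\<^sup>t - 1\<close> vanishes at their points, that is, if it is
  \<open>- v\<^sub>T \<delta>\<^bsup>T+1\<^esup> \<Prod>(z - z\<^sub>j)\<close>; comparing coefficients gives \<open>v\<close>.
\<close>
lemma ex_absorbing_shift:
  assumes "finite S" "card S = T" "0 < T" "0 < \<delta>"
  shows "\<exists>v. (\<forall>j\<in>S. node_noise T \<delta> v j = 1) \<and> \<bar>v T\<bar> \<le> 1 \<and>
    (\<forall>t\<in>{1..<T}. \<bar>v t\<bar> \<le> \<delta> * \<bar>coeff (node_poly S) t\<bar>)"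
proof -
  define q where "q = node_poly S"
  define c where "c = coeff q 0"
  have "degree q = T"
    unfolding q_def node_poly_def using assms by (subst degree_prod_eq_sum_degree) auto
  moreover have "lead_coeff q = 1"
    unfolding q_def node_poly_def by (simp add: lead_coeff_prod)
  ultimately have deg: "degree q = T" "coeff q T = 1" by auto
  have "c = (\<Prod>j\<in>S. real (Suc j))"
    unfolding c_def q_def node_poly_def node_pt_def by (simp add: poly_0_coeff_0[symmetric] poly_prod add.commute)
  then have c: "0 < c" by (simp add: prod_pos)
  \<comment> \<open>\<open>r\<close> is forced by the constant coefficients:
    \<open>r - 1 = - r * \<delta> ^ (T + 1) * c\<close>. Since \<open>c\<close> is positive,
    \<open>r\<close> is at most 1.\<close>
  define r where "r = 1 / (1 + \<delta> ^ (T + 1) * c)"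
  have pos: "0 < 1 + \<delta> ^ (T + 1) * c" using c assms by (intro add_pos_nonneg) auto
  have r: "0 < r" "r \<le> 1" "r * (1 + \<delta> ^ (T + 1) * c) = 1"
    using pos c assms by (auto simp: r_def)
  \<comment> \<open>At order \<open>t\<close> the comparison reads
    \<open>\<delta> ^ T * v t = - r * \<delta> ^ (T + 1) * coeff q t\<close>.\<close>
  define v where "v = (\<lambda>t. if t = T then r else - r * \<delta> * coeff q t)"
  have "node_noise T \<delta> v j = 1" if "j \<in> S" for j
  proof -
    define z where "z = node_pt j"
    have "poly q z = 0"
      unfolding q_def node_poly_def poly_prod using that assms by (auto simp: z_def intro!: prod_zero)
    then have "(\<Sum>t\<le>T. coeff q t * z ^ t) = 0"
      by (simp add: poly_altdef deg)
    moreover have "{..T} = insert 0 (insert T {1..<T})" using assms by auto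
    ultimately have root: "c + z ^ T + (\<Sum>t\<in>{1..<T}. coeff q t * z ^ t) = 0"
      using assms by (simp add: c_def deg)
    have "{1..T} = insert T {1..<T}" using assms by auto
    then have "node_noise T \<delta> v j = r * (1 - \<delta> ^ (T + 1) * z ^ T) + (\<Sum>t\<in>{1..<T}. gain T \<delta> z t * v t)"
      unfolding node_noise_def z_def[symmetric] by (simp add: gain_def v_def)
    also have "(\<Sum>t\<in>{1..<T}. gain T \<delta> z t * v t) = (\<Sum>t\<in>{1..<T}. (- r * \<delta> ^ (T + 1)) * (coeff q t * z ^ t))"
      by (intro sum.cong) (auto simp: gain_def v_def)
    also have "\<dots> = (- r * \<delta> ^ (T + 1)) * (\<Sum>t\<in>{1..<T}. coeff q t * z ^ t)"
      by (simp only: sum_distrib_left)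
    also have "(\<Sum>t\<in>{1..<T}. coeff q t * z ^ t) = - c - z ^ T" using root by linarith
    also have "r * (1 - \<delta> ^ (T + 1) * z ^ T) + (- r * \<delta> ^ (T + 1)) * (- c - z ^ T) = r * (1 + \<delta> ^ (T + 1) * c)"
      by (simp add: algebra_simps)
    finally show ?thesis using r by simp
  qed
  moreover have "\<bar>v T\<bar> \<le> 1" using r by (simp add: v_def)
  moreover have "\<bar>v t\<bar> \<le> \<delta> * \<bar>coeff q t\<bar>" if "t \<in> {1..<T}" for t
  proof -
    have "\<bar>v t\<bar> = r * (\<delta> * \<bar>coeff q t\<bar>)" using that r assms by (simp add: v_def abs_mult)
    also have "\<dots> \<le> 1 * (\<delta> * \<bar>coeff q t\<bar>)" using r assms by (intro mult_right_mono) auto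
    finally show ?thesis by simp
  qed
  ultimately show ?thesis unfolding q_def by blast
qed

section \<open>The law of the stored noise and its privacy\<close>

lemma node_noise_measurable:
  "(\<lambda>g. \<lambda>j\<in>J. node_noise T \<delta> g j) \<in> PiM {1..T} (\<lambda>_. borel) \<rightarrow>\<^sub>M PiM J (\<lambda>_. borel)"
  unfolding node_noise_def by measurable

lemma sets_PiM_borel:
  assumes "\<And>t. sets (\<rho> t) = sets borel"
  shows "sets (PiM I \<rho>) = sets (PiM I (\<lambda>_. borel))"
  by (intro sets_PiM_cong) (auto simp: assms)

lemma node_noise_measurable':
  assumes "\<And>t. sets (\<rho> t) = sets borel"
  shows "(\<lambda>g. \<lambda>j\<in>J. node_noise T \<delta> g j) \<in> PiM {1..T} \<rho> \<rightarrow>\<^sub>M PiM J (\<lambda>_. borel)"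
  by (subst measurable_cong_sets[OF sets_PiM_borel refl]) (rule assms node_noise_measurable)+

lemma is_noise_law_noise_law:
  assumes prob: "\<And>t. prob_space (\<rho> t)" and sets: "\<And>t. sets (\<rho> t) = sets borel"
    and int: "\<And>t. integrable (\<rho> t) (\<lambda>x. x)" and mean: "\<And>t. (\<integral>x. x \<partial>\<rho> t) = 0"
  shows "is_noise_law N (noise_law N T \<delta> \<rho>)"
proof -
  interpret Q: prob_space "PiM {1..T} \<rho>" by (intro prob_space_PiM prob)
  note meas = node_noise_measurable'[OF sets]
  have comp: "integrable (PiM {1..T} \<rho>) (\<lambda>g. g t) \<and> (\<integral>g. g t \<partial>PiM {1..T} \<rho>) = 0" if "t \<in> {1..T}" for t
  proof -
    have c: "(\<lambda>g. g t) \<in> PiM {1..T} \<rho> \<rightarrow>\<^sub>M \<rho> t" using that by measurable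
    have d: "distr (PiM {1..T} \<rho>) (\<rho> t) (\<lambda>g. g t) = \<rho> t" using that by (intro distr_PiM_component prob)
    have m: "(\<lambda>x. x) \<in> borel_measurable (\<rho> t)" using int[of t] by auto
    show ?thesis
      using integrable_distr_eq[OF c m] integral_distr[OF c m] int[of t] mean[of t] unfolding d by simp
  qed
  have "integrable (PiM {1..T} \<rho>) (\<lambda>g. node_noise T \<delta> g j)" for j
    unfolding node_noise_def using comp by (intro Bochner_Integration.integrable_sum integrable_mult_right) auto
  moreover have "(\<integral>g. node_noise T \<delta> g j \<partial>PiM {1..T} \<rho>) = 0" for j
    unfolding node_noise_def using comp by (subst Bochner_Integration.integral_sum) auto
  moreover have "(\<lambda>r. r j) \<in> borel_measurable (PiM {..<N} (\<lambda>_. borel :: real measure))" if "j < N" for j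
    using that by simp
  ultimately show ?thesis
    unfolding is_noise_law_def noise_law_def
    by (intro conjI allI impI Q.prob_space_distr[OF meas] sets_distr)
      (simp_all only: integrable_distr_eq[OF meas] integral_distr[OF meas] restrict_apply' lessThan_iff)
qed

text \<open>On the nodes of a set \<open>S\<close> an input value \<open>a\<close> acts like the
  shift \<open>a * v\<close> of the independent noises, where \<open>v\<close> is the absorbing
  shift; composition then gives the bound. The assumption \<open>small\<close> keeps the auxiliary
  components of \<open>v\<close> within 1 for every \<open>S\<close>.\<close>

lemma node_DP_noise_law:
  assumes prob: "\<And>t. prob_space (\<rho> t)" and sets: "\<And>t. sets (\<rho> t) = sets borel"
    and DP: "\<And>t. shift_DP (e t) (\<rho> t)" and e: "(\<Sum>t\<in>{1..T}. e t) \<le> \<epsilon>"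
    and T: "0 < T" and \<delta>: "0 < \<delta>"
    and small: "\<And>S t. S \<subseteq> {..<N} \<Longrightarrow> t < T \<Longrightarrow> \<delta> * \<bar>coeff (node_poly S) t\<bar> \<le> 1"
  shows "node_DP N T \<epsilon> (noise_law N T \<delta> \<rho>)"
  unfolding node_DP_def
proof (intro allI impI, elim conjE)
  fix S and a0 a1 :: real and B
  assume S: "S \<subseteq> {..<N}" "card S = T" and a: "\<bar>a0 - a1\<bar> \<le> 1"
    and B[measurable]: "B \<in> sets (PiM S (\<lambda>_. borel :: real measure))"
  let ?Q = "PiM {1..T} \<rho>" and ?\<mu> = "noise_law N T \<delta> \<rho>"
  interpret Q: prob_space ?Q by (intro prob_space_PiM prob)
  interpret \<mu>: prob_space ?\<mu>
    unfolding noise_law_def by (rule Q.prob_space_distr[OF node_noise_measurable'[OF sets]])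
  have "finite S" using S finite_subset by blast
  then obtain v where v: "\<And>j. j \<in> S \<Longrightarrow> node_noise T \<delta> v j = 1" "\<bar>v T\<bar> \<le> 1"
      "\<And>t. t \<in> {1..<T} \<Longrightarrow> \<bar>v t\<bar> \<le> \<delta> * \<bar>coeff (node_poly S) t\<bar>"
    using ex_absorbing_shift[OF _ S(2) T \<delta>] by blast
  have v1: "\<bar>v t\<bar> \<le> 1" if "t \<in> {1..T}" for t
  proof (cases "t = T")
    case False
    then have "t \<in> {1..<T}" using that by auto
    then show ?thesis using v(3)[of t] small[OF S(1), of t] by auto
  qed (use v in auto)
  define F :: "(nat \<Rightarrow> real) \<Rightarrow> ennreal" where "F = (\<lambda>h. indicator B (\<lambda>j\<in>S. node_noise T \<delta> h j))"
  have F: "F \<in> borel_measurable (PiM {1..T} (\<lambda>_. borel))"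
    unfolding F_def 
    by (rule measurable_compose[OF node_noise_measurable borel_measurable_indicator[OF B]])
  \<comment> \<open>For every input value the event is the same function \<open>F\<close>, evaluated
    at noises shifted by a multiple of \<open>v\<close>.\<close>
  have em: "emeasure ?\<mu> {r \<in> space ?\<mu>. (\<lambda>j\<in>S. a + r j) \<in> B} = (\<integral>\<^sup>+g. F (\<lambda>t\<in>{1..T}. g t + a * v t) \<partial>?Q)" for a
  proof -
    have [measurable]: "(\<lambda>r. \<lambda>j\<in>S. a + r j) \<in> PiM {..<N} (\<lambda>_. borel) \<rightarrow>\<^sub>M PiM S (\<lambda>_. borel)"
      using S by (intro measurable_restrict) (auto intro!: borel_measurable_add measurable_component_singleton)
    have sets\<mu>[measurable_cong]: "sets ?\<mu> = sets (PiM {..<N} (\<lambda>_. borel))" by (simp add: noise_law_def)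
    have "{r \<in> space ?\<mu>. (\<lambda>j\<in>S. a + r j) \<in> B} \<in> sets ?\<mu>" by measurable
    then have "emeasure ?\<mu> {r \<in> space ?\<mu>. (\<lambda>j\<in>S. a + r j) \<in> B}
       = (\<integral>\<^sup>+r. indicator {r \<in> space ?\<mu>. (\<lambda>j\<in>S. a + r j) \<in> B} r \<partial>?\<mu>)"
      by simp
    also have "\<dots> = (\<integral>\<^sup>+r. indicator B (\<lambda>j\<in>S. a + r j) \<partial>?\<mu>)"
      by (intro nn_integral_cong) (auto simp: indicator_def)
    also have "\<dots> = (\<integral>\<^sup>+g. indicator B (\<lambda>j\<in>S. a + (\<lambda>j\<in>{..<N}. node_noise T \<delta> g j) j) \<partial>?Q)"
      unfolding noise_law_def
      by (subst nn_integral_distr[OF node_noise_measurable'[OF sets]]) measurable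
    also have "\<dots> = (\<integral>\<^sup>+g. F (\<lambda>t\<in>{1..T}. g t + a * v t) \<partial>?Q)"
    proof -
      have "(\<lambda>j\<in>S. a + (\<lambda>j\<in>{..<N}. node_noise T \<delta> g j) j)
         = (\<lambda>j\<in>S. node_noise T \<delta> (\<lambda>t\<in>{1..T}. g t + a * v t) j)" for g
      proof (rule restrict_ext)
        fix j assume j: "j \<in> S"
        have "node_noise T \<delta> (\<lambda>t\<in>{1..T}. g t + a * v t) j = node_noise T \<delta> g j + a * node_noise T \<delta> v j"
          unfolding node_noise_def sum_distrib_left
          by (subst sum.distrib[symmetric]) (auto intro!: sum.cong simp: algebra_simps)
        then show "a + (\<lambda>j\<in>{..<N}. node_noise T \<delta> g j) j = node_noise T \<delta> (\<lambda>t\<in>{1..T}. g t + a * v t) j"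
          using v(1)[OF j] j S by auto
      qed
      then show ?thesis by (simp add: F_def)
    qed
    finally show ?thesis .
  qed
  have "(\<integral>\<^sup>+g. F (\<lambda>t\<in>{1..T}. g t + a0 * v t) \<partial>?Q)
     \<le> ennreal (exp (\<Sum>t\<in>{1..T}. e t)) * (\<integral>\<^sup>+g. F (\<lambda>t\<in>{1..T}. g t + a1 * v t) \<partial>?Q)"
  proof (rule nn_integral_PiM_shift_le[OF _ prob sets DP _ F])
    fix t assume "t \<in> {1..T}"
    from v1[OF this] a have "\<bar>a0 - a1\<bar> * \<bar>v t\<bar> \<le> 1 * 1" by (intro mult_mono) auto
    then show "\<bar>a0 * v t - a1 * v t\<bar> \<le> 1"
      by (simp add: abs_mult[symmetric] left_diff_distrib)
  qed simp
  also have "\<dots> \<le> ennreal (exp \<epsilon>) * (\<integral>\<^sup>+g. F (\<lambda>t\<in>{1..T}. g t + a1 * v t) \<partial>?Q)"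
    using e by (intro mult_right_mono) (auto intro: ennreal_leI)
  finally have "emeasure ?\<mu> {r \<in> space ?\<mu>. (\<lambda>j\<in>S. a0 + r j) \<in> B}
     \<le> ennreal (exp \<epsilon>) * emeasure ?\<mu> {r \<in> space ?\<mu>. (\<lambda>j\<in>S. a1 + r j) \<in> B}"
    by (simp only: em)
  then show "measure ?\<mu> {r \<in> space ?\<mu>. (\<lambda>j\<in>S. a0 + r j) \<in> B}
     \<le> exp \<epsilon> * measure ?\<mu> {r \<in> space ?\<mu>. (\<lambda>j\<in>S. a1 + r j) \<in> B}"
    by (simp add: \<mu>.emeasure_eq_measure ennreal_mult[symmetric])
qed

section \<open>Decoding\<close>

text \<open>\<open>L j m\<close> is the coefficient of order \<open>m\<close> of the
  \<open>j\<close>-th Lagrange basis polynomial: interpolating the \<open>k\<close>-th power at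
  \<open>n\<close> points reproduces it when \<open>k < n\<close>.\<close>

lemma ex_inverse_vandermonde:
  fixes z :: "nat \<Rightarrow> 'a::field"
  assumes inj: "inj_on z {..<n}"
  shows "\<exists>L. \<forall>m<n. \<forall>k<n. (\<Sum>j<n. L j m * z j ^ k) = (if k = m then 1 else 0)"
proof -
  define \<Lambda> where "\<Lambda> = (\<lambda>j. smult (1 / (\<Prod>i\<in>{..<n} - {j}. z j - z i)) (\<Prod>i\<in>{..<n} - {j}. [:- z i, 1:]))"
  have nz: "(\<Prod>i\<in>{..<n} - {j}. z j - z i) \<noteq> 0" if "j < n" for j
    using that inj by (auto simp: inj_on_def)
  have eval: "poly (\<Lambda> j) (z i) = (if i = j then 1 else 0)" if "j < n" "i < n" for i j
  proof (cases "i = j")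
    case True
    then show ?thesis using nz[OF that(1)] by (simp add: \<Lambda>_def poly_prod)
  next
    case False
    then have "(\<Prod>k\<in>{..<n} - {j}. z i - z k) = 0" using that by (intro prod_zero) auto
    then show ?thesis using False by (simp add: \<Lambda>_def poly_prod)
  qed
  have deg: "degree (\<Lambda> j) < n" if "j < n" for j
  proof -
    have "degree (\<Lambda> j) \<le> degree (\<Prod>i\<in>{..<n} - {j}. [:- z i, 1:])" unfolding \<Lambda>_def by (rule degree_smult_le)
    also have "\<dots> \<le> (\<Sum>i\<in>{..<n} - {j}. degree [:- z i, 1:])"
      using degree_prod_sum_le[of "{..<n} - {j}" "\<lambda>i. [:- z i, 1:]"] by (simp add: o_def)
    also have "\<dots> < n" using that by simp
    finally show ?thesis .
  qed
  have interp: "(\<Sum>j<n. smult (z j ^ k) (\<Lambda> j)) = monom 1 k" if k: "k < n" for k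
  proof (rule poly_eqI_degree[where A="z ` {..<n}"])
    fix x assume "x \<in> z ` {..<n}"
    then obtain i where i: "i < n" "x = z i" by auto
    have "poly (\<Sum>j<n. smult (z j ^ k) (\<Lambda> j)) (z i) = (\<Sum>j<n. z j ^ k * (if i = j then 1 else 0))"
      unfolding poly_sum poly_smult using eval i by (intro sum.cong) auto
    also have "\<dots> = z i ^ k" using i by (simp add: if_distrib[of "\<lambda>x. _ * x"] cong: if_cong)
    finally show "poly (\<Sum>j<n. smult (z j ^ k) (\<Lambda> j)) x = poly (monom 1 k) x"
      by (simp add: i poly_monom)
  next
    have card: "card (z ` {..<n}) = n" using inj by (simp add: card_image)
    show "degree (\<Sum>j<n. smult (z j ^ k) (\<Lambda> j)) < card (z ` {..<n})"
      unfolding card using k deg by (intro degree_sum_less) (auto intro: le_less_trans[OF degree_smult_le])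
    show "degree (monom (1::'a) k) < card (z ` {..<n})"
      unfolding card using k by (simp add: degree_monom_eq)
  qed
  have "(\<Sum>j<n. coeff (\<Lambda> j) m * z j ^ k) = (if k = m then 1 else 0)" if "k < n" for k m
  proof -
    have "(\<Sum>j<n. coeff (\<Lambda> j) m * z j ^ k) = coeff (\<Sum>j<n. smult (z j ^ k) (\<Lambda> j)) m"
      by (simp add: coeff_sum mult.commute)
    then show ?thesis unfolding interp[OF that] by simp
  qed
  then show ?thesis by (intro exI[of _ "\<lambda>j m. coeff (\<Lambda> j) m"]) auto
qed

section \<open>Expansion in powers of the node point and the limiting decoder weights\<close>

text \<open>
  In powers of the node point, the coefficient of order 0 is \<open>A + R\<close> and the one of order \<open>T\<close> carries
  the main noise again.
\<close>
definition amp :: "nat \<Rightarrow> real \<Rightarrow> nat \<Rightarrow> real" where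
  "amp T \<delta> t = (if t = 0 then 1 else if t = T then - (\<delta> ^ (T + 1)) else \<delta> ^ T)"

definition layer :: "nat \<Rightarrow> real \<times> (nat \<Rightarrow> real) \<Rightarrow> nat \<Rightarrow> real" where
  "layer T x t = (if t = 0 then fst x + snd x T else snd x t)"

text \<open>With these weights the layers combine to c A - (1 - c) R. For c = 1 this is the input;
  for c = 1 - \<alpha> it is the error A - \<alpha> (A + R) of the Wiener estimate.\<close>

definition wiener_coeff :: "nat \<Rightarrow> real \<Rightarrow> nat \<Rightarrow> real" where
  "wiener_coeff T c t = (if t = 0 then c else if t = T then - 1 else 0)"

text \<open>The gain of the main noise is split: its constant part joins the input at order 0, its
  small part stays at order \<open>T\<close>.\<close>

lemma node_value_expansion:
  assumes "0 < T"
  shows "fst x + node_noise T \<delta> (snd x) j = (\<Sum>t\<le>T. amp T \<delta> t * node_pt j ^ t * layer T x t)"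
proof -
  have s: "{..T} = insert 0 (insert T {1..<T})" "{1..T} = insert T {1..<T}" using assms by auto
  have "(\<Sum>t\<in>{1..<T}. gain T \<delta> (node_pt j) t * snd x t) = (\<Sum>t\<in>{1..<T}. amp T \<delta> t * node_pt j ^ t * layer T x t)"
    by (intro sum.cong) (auto simp: gain_def amp_def layer_def)
  then show ?thesis
    unfolding node_noise_def s using assms
    by (simp add: gain_def amp_def layer_def algebra_simps)
qed

lemma sum_wiener_coeff_layer:
  assumes "0 < T"
  shows "(\<Sum>t\<le>T. wiener_coeff T c t * layer T x t) = c * fst x - (1 - c) * snd x T"
proof -
  have s: "{..T} = insert 0 (insert T {1..<T})" using assms by auto
  have "(\<Sum>t\<in>{1..<T}. wiener_coeff T c t * layer T x t) = 0"
    by (intro sum.neutral) (auto simp: wiener_coeff_def)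
  then show ?thesis
    unfolding s using assms by (simp add: wiener_coeff_def layer_def algebra_simps)
qed

lemma tendsto_power_divide_power_0:
  fixes h m :: nat
  assumes "m < h"
  shows "((\<lambda>\<delta>::real. \<delta> ^ h / \<delta> ^ m) \<longlongrightarrow> 0) (at_right 0)"
proof -
  have "((\<lambda>\<delta>::real. \<delta> ^ (h - m)) \<longlongrightarrow> 0 ^ (h - m)) (at_right 0)"
    by (intro tendsto_intros)
  then have "((\<lambda>\<delta>::real. \<delta> ^ (h - m)) \<longlongrightarrow> 0) (at_right 0)"
    using assms by (simp add: zero_power)
  moreover have "\<forall>\<^sub>F \<delta>::real in at_right 0. \<delta> ^ (h - m) = \<delta> ^ h / \<delta> ^ m"
    using eventually_at_right_less by eventually_elim (use assms in \<open>simp add: power_diff\<close>)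
  ultimately show ?thesis by (rule Lim_transform_eventually)
qed

lemma prod_wiener_coeff:
  assumes "finite I" "0 < T" "\<And>i. i \<in> I \<Longrightarrow> f i \<in> {0, T}"
  shows "(\<Prod>i\<in>I. wiener_coeff T c (f i)) = c ^ (card I - card {i\<in>I. f i = T}) * (-1) ^ card {i\<in>I. f i = T}"
proof -
  have "(\<Prod>i\<in>I. wiener_coeff T c (f i)) = (\<Prod>i\<in>I. if f i = T then -1 else c)"
    using assms by (intro prod.cong) (force simp: wiener_coeff_def)+
  also have "\<dots> = (-1) ^ card {i\<in>I. f i = T} * c ^ card (I - {i\<in>I. f i = T})"
    using assms(1) by (subst prod.If_cases) (auto simp: Int_def Diff_eq Compl_eq intro!: arg_cong2[where f="(*)"] arg_cong2[where f="(^)"] arg_cong[where f=card])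
  finally show ?thesis using assms(1) by (simp add: card_Diff_subset mult.commute)
qed

text \<open>\<open>f\<close> selects one layer from each factor; the resulting term carries the
  power n of z and h of \<delta>. If all choices are 0 or \<open>T\<close>, with K <
  \<open>M\<close> of them equal to \<open>T\<close>, then n = T K and h = (T + 1) K, so the part of
  the decoder with k = K returns (-1)^K (1 - c^(M - K)), which is the target weight. All other
  contributions either are annihilated by \<open>L\<close> or keep a positive power of
  \<delta>.\<close>

lemma decoding_coeff_tendsto:
  fixes L :: "nat \<Rightarrow> nat \<Rightarrow> real" and f :: "nat \<Rightarrow> nat" and c :: real
  assumes T: "0 < T" and M: "0 < M"
    and L: "\<And>m k. m < (M - 1) * T + 1 \<Longrightarrow> k < (M - 1) * T + 1 \<Longrightarrow>
      (\<Sum>j<(M - 1) * T + 1. L j m * z j ^ k) = (if k = m then 1 else 0)"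
    and f: "\<And>i. i < M \<Longrightarrow> f i \<le> T"
  defines "d \<equiv> \<lambda>\<delta> j. \<Sum>k<M. L j (k * T) * (1 - c ^ (M - k)) / \<delta> ^ ((T + 1) * k)"
  shows "((\<lambda>\<delta>. (\<Prod>i<M. amp T \<delta> (f i)) * (\<Sum>j<(M - 1) * T + 1. d \<delta> j * z j ^ (\<Sum>i<M. f i)))
    \<longlongrightarrow> (\<Prod>i<M. wiener_coeff T 1 (f i)) - (\<Prod>i<M. wiener_coeff T c (f i))) (at_right 0)"
proof -
  define N0 where "N0 = (M - 1) * T + 1"
  define n where "n = (\<Sum>i<M. f i)"
  \<comment> \<open>The exponent of \<delta> in \<open>amp\<close>; the signs are collected in
    \<open>s\<close>.\<close>
  define ht where "ht = (\<lambda>t. if t = 0 then 0 else if t = T then T + 1 else T)"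
  define h where "h = (\<Sum>i<M. ht (f i))"
  define s :: real where "s = (\<Prod>i<M. if f i = T then -1 else 1)"
  define b where "b = (\<lambda>k. \<Sum>j<N0. L j (k * T) * z j ^ n)"
  define e where "e = (\<lambda>k. 1 - c ^ (M - k))"
  define K where "K = card {i\<in>{..<M}. f i = T}"
  define P where "P \<longleftrightarrow> (\<forall>i<M. f i \<in> {0, T})"
  have amp: "(\<Prod>i<M. amp T \<delta> (f i)) = s * \<delta> ^ h" for \<delta>
  proof -
    have "(\<Prod>i<M. amp T \<delta> (f i)) = (\<Prod>i<M. (if f i = T then -1 else 1) * \<delta> ^ ht (f i))"
      using T by (intro prod.cong) (auto simp: amp_def ht_def)
    then show ?thesis by (simp add: prod.distrib s_def h_def power_sum)
  qed
  have expand: "(\<Prod>i<M. amp T \<delta> (f i)) * (\<Sum>j<N0. d \<delta> j * z j ^ n)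
     = (\<Sum>k<M. s * e k * b k * (\<delta> ^ h / \<delta> ^ ((T + 1) * k)))" for \<delta>
  proof -
    have "(\<Sum>j<N0. d \<delta> j * z j ^ n) = (\<Sum>j<N0. \<Sum>k<M. e k / \<delta> ^ ((T + 1) * k) * (L j (k * T) * z j ^ n))"
      unfolding d_def e_def sum_distrib_right by (intro sum.cong) auto
    also have "\<dots> = (\<Sum>k<M. e k / \<delta> ^ ((T + 1) * k) * b k)"
      unfolding b_def sum_distrib_left by (rule sum.swap)
    finally show ?thesis
      by (simp only: amp sum_distrib_left) (intro sum.cong, auto)
  qed
  \<comment> \<open>Equality holds only at 0 and \<open>T\<close>. In between, (T + 1) t \<le> (T +
    1) (T - 1) = T^2 - 1; this gap suppresses the auxiliary noises.\<close>
  have ht: "(T + 1) * t \<le> T * ht t" "t \<notin> {0, T} \<Longrightarrow> (T + 1) * t < T * ht t" if "t \<le> T" for t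
  proof -
    have "(T + 1) * t < T * T" if "0 < t" "t < T"
    proof -
      have "(T + 1) * t \<le> (T + 1) * (T - 1)" using that by (intro mult_left_mono) auto
      also have "\<dots> < T * T" using that by (cases T) (auto simp: algebra_simps)
      finally show ?thesis .
    qed
    then show "(T + 1) * t \<le> T * ht t" "t \<notin> {0, T} \<Longrightarrow> (T + 1) * t < T * ht t"
      using that by (auto simp: ht_def less_imp_le)
  qed
  have Th: "(T + 1) * n \<le> T * h"
    unfolding n_def h_def sum_distrib_left using f ht(1) by (intro sum_mono) auto
  have Th': "(T + 1) * n < T * h" if "\<not> P"
    unfolding n_def h_def sum_distrib_left
  proof (rule sum_strict_mono_ex1)
    show "\<exists>i\<in>{..<M}. (T + 1) * f i < T * ht (f i)"
      using that f ht(2) unfolding P_def by (meson lessThan_iff)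
  qed (use f ht(1) in auto)
  have onP: "n = T * K" "h = (T + 1) * K" "s = (-1) ^ K" if P
  proof -
    have "n = (\<Sum>i<M. if f i = T then T else 0)"
      unfolding n_def using that by (intro sum.cong) (auto simp: P_def)
    then show "n = T * K" by (simp add: sum.If_cases K_def Int_def)
    have "h = (\<Sum>i<M. if f i = T then T + 1 else 0)"
      unfolding h_def using that T by (intro sum.cong) (auto simp: P_def ht_def)
    then show "h = (T + 1) * K" by (simp add: sum.If_cases K_def Int_def)
    show "s = (-1) ^ K" by (simp add: s_def prod.If_cases K_def Int_def)
  qed
  have lim: "((\<lambda>\<delta>. s * e k * b k * (\<delta> ^ h / \<delta> ^ ((T + 1) * k))) \<longlongrightarrow> (if P \<and> k = K then s * e k else 0)) (at_right 0)"
    if k: "k < M" for k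
  proof -
    have kT: "k * T \<le> (M - 1) * T" using k by (intro mult_right_mono) auto
    have "k * T < (M - 1) * T + 1" using kT by linarith
    then have bk: "b k = (if n = k * T then 1 else 0)" if "n \<le> (M - 1) * T"
      unfolding b_def N0_def by (rule L) (use that in linarith)
    have zero: ?thesis if "(T + 1) * k < h" "\<not> (P \<and> k = K)"
      unfolding if_not_P[OF that(2)]
      by (rule tendsto_mult_right_zero[OF tendsto_power_divide_power_0[OF that(1)]])
    consider "n > (M - 1) * T" | "n \<le> (M - 1) * T" "n \<noteq> k * T" | "n = k * T" by linarith
    then show ?thesis
    proof cases
      \<comment> \<open>Beyond degree (M - 1) T interpolation says nothing about \<open>b k\<close>,
        but the power of \<delta> is high enough: T h \<ge> (T + 1) n > T (T + 1) k.\<close>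
      case 1
      then have "k * T < n" using kT by linarith
      then have "(T + 1) * (k * T) < (T + 1) * n" by (intro mult_strict_left_mono) auto
      then have "T * ((T + 1) * k) < (T + 1) * n" by (simp only: mult_ac)
      then have "T * ((T + 1) * k) < T * h" using Th by (rule less_le_trans)
      then have "(T + 1) * k < h" by simp
      moreover have "\<not> (P \<and> k = K)" using onP(1) \<open>k * T < n\<close> by (auto simp: mult.commute)
      ultimately show ?thesis by (rule zero)
    next
      case 2
      have "b k = 0" using bk 2 by simp
      moreover have "\<not> (P \<and> k = K)" using onP(1) 2 by (auto simp: mult.commute)
      ultimately show ?thesis by (auto simp only: if_False mult_zero_right mult_zero_left tendsto_const)
    next
      case 3
      \<comment> \<open>At the matching order the powers of \<delta> cancel exactly when no
        auxiliary layer is selected; otherwise \<open>Th'\<close> leaves a positive power.\<close>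
      have b: "b k = 1" using bk[OF kT[folded 3]] 3 by simp
      show ?thesis
      proof (cases P)
        case True
        then have "k = K" using 3 onP(1) T by (simp add: mult.commute)
        moreover have "\<forall>\<^sub>F \<delta> in at_right (0::real). s * e k = s * e k * b k * (\<delta> ^ h / \<delta> ^ ((T + 1) * k))"
          using eventually_at_right_less
          by eventually_elim (use b onP(2)[OF True] \<open>k = K\<close> in simp)
        ultimately show ?thesis
          using True by (simp add: Lim_transform_eventually[OF tendsto_const])
      next
        case False
        have "T * ((T + 1) * k) < T * h" using Th'[OF False] 3 by (simp add: mult_ac)
        then have "(T + 1) * k < h" by simp
        then show ?thesis using False by (intro zero) auto
      qed
    qed
  qed
  have "((\<lambda>\<delta>. \<Sum>k<M. s * e k * b k * (\<delta> ^ h / \<delta> ^ ((T + 1) * k))) \<longlongrightarrow> (\<Sum>k<M. if P \<and> k = K then s * e k else 0)) (at_right 0)"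
    using lim by (intro tendsto_sum) auto
  moreover have "(\<Sum>k<M. if P \<and> k = K then s * e k else 0)
     = (\<Prod>i<M. wiener_coeff T 1 (f i)) - (\<Prod>i<M. wiener_coeff T c (f i))"
  proof (cases P)
    case True
    have "K \<le> M" unfolding K_def using card_mono[of "{..<M}" "{i\<in>{..<M}. f i = T}"] by auto
    \<comment> \<open>For \<open>K = M\<close> no \<open>k < M\<close> matches, but then
      \<open>e K = 1 - c ^ 0\<close> is zero. This is why the coefficient of order M T can be
      missing.\<close>
    have "(\<Sum>k<M. if P \<and> k = K then s * e k else 0) = s * e K"
      using True \<open>K \<le> M\<close> by (cases "K = M") (auto simp: e_def)
    also have "\<dots> = (\<Prod>i<M. wiener_coeff T 1 (f i)) - (\<Prod>i<M. wiener_coeff T c (f i))"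
      using True by (subst (1 2) prod_wiener_coeff) (auto simp: P_def T e_def onP(3) K_def algebra_simps)
    finally show ?thesis .
  next
    case False
    then obtain i where "i < M" "f i \<notin> {0, T}" by (auto simp: P_def)
    then have zero: "(\<Prod>i<M. wiener_coeff T c (f i)) = 0" for c
      by (intro prod_zero) (auto simp: wiener_coeff_def)
    show ?thesis unfolding zero using False by simp
  qed
  ultimately show ?thesis
    unfolding expand[symmetric] by (simp add: N0_def n_def)
qed

section \<open>Mean square error\<close>

text \<open>The weight that the decoder gives to the term selected by \<open>f\<close>, minus its
  weight in the product of the inputs less the product of the Wiener errors.\<close>

definition residual_coeff :: "nat \<Rightarrow> nat \<Rightarrow> nat \<Rightarrow> real \<Rightarrow> real \<Rightarrow> (nat \<Rightarrow> real) \<Rightarrow> (nat \<Rightarrow> nat) \<Rightarrow> real" where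
  "residual_coeff N M T c \<delta> d f = (\<Prod>i<M. amp T \<delta> (f i)) * (\<Sum>j<N. d j * node_pt j ^ (\<Sum>i<M. f i))
     - ((\<Prod>i<M. wiener_coeff T 1 (f i)) - (\<Prod>i<M. wiener_coeff T c (f i)))"

text \<open>All products are expanded over the choice functions \<open>f\<close>. The identity is
  exact for every \<delta>: the product of the Wiener errors stands apart, and every imperfection of
  the decoder sits in the residual weights.\<close>

lemma decoding_error_expansion:
  assumes "0 < T"
  shows "(\<Sum>j<N. d j * (\<Prod>i<M. fst (x i) + node_noise T \<delta> (snd (x i)) j)) - (\<Prod>i<M. fst (x i))
    = (\<Sum>f\<in>Pi\<^sub>E {..<M} (\<lambda>_. {..T}). residual_coeff N M T c \<delta> d f * (\<Prod>i<M. layer T (x i) (f i)))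
      - (\<Prod>i<M. c * fst (x i) - (1 - c) * snd (x i) T)"
proof -
  let ?F = "Pi\<^sub>E {..<M} (\<lambda>_. {..T})" and ?Y = "\<lambda>f. \<Prod>i<M. layer T (x i) (f i)"
  have W: "(\<Prod>i<M. c * fst (x i) - (1 - c) * snd (x i) T) = (\<Sum>f\<in>?F. (\<Prod>i<M. wiener_coeff T c (f i)) * ?Y f)" for c
    unfolding sum_wiener_coeff_layer[OF assms, symmetric] by (subst prod_sum_PiE) (auto simp: prod.distrib)
  from W[of 1] have A: "(\<Prod>i<M. fst (x i)) = (\<Sum>f\<in>?F. (\<Prod>i<M. wiener_coeff T 1 (f i)) * ?Y f)" by simp
  have "(\<Prod>i<M. fst (x i) + node_noise T \<delta> (snd (x i)) j)
     = (\<Sum>f\<in>?F. (\<Prod>i<M. amp T \<delta> (f i)) * node_pt j ^ (\<Sum>i<M. f i) * ?Y f)" for j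
    unfolding node_value_expansion[OF assms] by (subst prod_sum_PiE) (auto simp: prod.distrib power_sum)
  then have "(\<Sum>j<N. d j * (\<Prod>i<M. fst (x i) + node_noise T \<delta> (snd (x i)) j))
     = (\<Sum>j<N. \<Sum>f\<in>?F. (\<Prod>i<M. amp T \<delta> (f i)) * (d j * node_pt j ^ (\<Sum>i<M. f i)) * ?Y f)"
    by (simp add: sum_distrib_left mult_ac)
  also have "\<dots> = (\<Sum>f\<in>?F. (\<Prod>i<M. amp T \<delta> (f i)) * (\<Sum>j<N. d j * node_pt j ^ (\<Sum>i<M. f i)) * ?Y f)"
    by (subst sum.swap) (simp add: sum_distrib_left sum_distrib_right)
  finally have D: "(\<Sum>j<N. d j * (\<Prod>i<M. fst (x i) + node_noise T \<delta> (snd (x i)) j)) = \<dots>" .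
  show ?thesis
    unfolding D A W[of c] residual_coeff_def sum_subtractf[symmetric]
    by (intro sum.cong) (auto simp: algebra_simps)
qed

text \<open>The main error \<open>x\<close> keeps a factor close to 1 for small \<open>s\<close>;
  the large factor falls on \<open>y\<close>, the residual part, which tends to zero.\<close>

lemma power2_diff_le_weighted:
  fixes x y s :: real
  assumes "0 < s"
  shows "(y - x)\<^sup>2 \<le> (1 + s) * x\<^sup>2 + (1 + 1 / s) * y\<^sup>2"
proof -
  have "0 \<le> (s * x + y)\<^sup>2 / s" using assms by simp
  also have "\<dots> = s * x\<^sup>2 + 2 * x * y + y\<^sup>2 / s"
    using assms by (simp add: power2_eq_square field_simps)
  finally show ?thesis by (simp add: power2_diff algebra_simps)
qed

text \<open>The input is integrated first: its zero mean removes the cross term for each fixed value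
  of the noise.\<close>

lemma nn_integral_square_input_noise_le:
  assumes \<nu>: "is_input_law \<eta> \<nu>"
    and prob: "\<And>t. prob_space (\<rho> t)" and sets: "\<And>t. sets (\<rho> t) = sets borel"
    and t: "t \<in> I" and v: "(\<integral>\<^sup>+x. ennreal (x\<^sup>2) \<partial>\<rho> t) \<le> ennreal v" "0 \<le> v"
  shows "(\<integral>\<^sup>+x. ennreal ((p * fst x + q * snd x t)\<^sup>2) \<partial>(\<nu> \<Otimes>\<^sub>M PiM I \<rho>)) \<le> ennreal (p\<^sup>2 * \<eta> + q\<^sup>2 * v)"
proof -
  interpret nu: prob_space \<nu> using \<nu> by (simp add: is_input_law_def)
  interpret Q: prob_space "PiM I \<rho>" by (intro prob_space_PiM prob)
  interpret P: pair_prob_space \<nu> "PiM I \<rho>" ..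
  have nu_sets[measurable_cong]: "sets \<nu> = sets borel" using \<nu> by (simp add: is_input_law_def)
  note sets[measurable_cong]
  have mean: "(\<integral>x. x \<partial>\<nu>) = 0" using \<nu> by (simp add: is_input_law_def)
  have I: "integrable \<nu> (\<lambda>x. x)" "integrable \<nu> (\<lambda>x. x\<^sup>2)" "(\<integral>x. x \<partial>\<nu>) = 0" "(\<integral>x. x\<^sup>2 \<partial>\<nu>) \<le> \<eta>"
    using \<nu> unfolding is_input_law_def mean by simp_all
  have [measurable]: "(\<lambda>g. g t) \<in> borel_measurable (PiM I \<rho>)"
    using measurable_component_singleton[OF t, of \<rho>] measurable_cong_sets[OF refl sets[of t]] by blast
  have "0 \<le> (\<integral>a. a\<^sup>2 \<partial>\<nu>)" by simp
  then have "0 \<le> \<eta>" using I(4) by linarith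
  have sq: "(\<lambda>x. ennreal (x\<^sup>2)) \<in> borel_measurable (\<rho> t)"
    unfolding measurable_cong_sets[OF sets refl] by measurable
  have inner: "(\<integral>\<^sup>+a. ennreal ((p * a + y)\<^sup>2) \<partial>\<nu>) \<le> ennreal (p\<^sup>2 * \<eta>) + ennreal (y\<^sup>2)" for y
  proof -
    have eq: "(p * a + y)\<^sup>2 = p\<^sup>2 * a\<^sup>2 + 2 * p * y * a + y\<^sup>2" for a
      by (simp add: power2_eq_square algebra_simps)
    have "integrable \<nu> (\<lambda>a. (p * a + y)\<^sup>2)"
      unfolding eq using I by (intro Bochner_Integration.integrable_add integrable_mult_right) auto
    then have "(\<integral>\<^sup>+a. ennreal ((p * a + y)\<^sup>2) \<partial>\<nu>) = ennreal (\<integral>a. (p * a + y)\<^sup>2 \<partial>\<nu>)"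
      by (intro nn_integral_eq_integral) auto
    also have "(\<integral>a. (p * a + y)\<^sup>2 \<partial>\<nu>) = p\<^sup>2 * (\<integral>a. a\<^sup>2 \<partial>\<nu>) + y\<^sup>2"
      unfolding eq using I by (simp add: nu.prob_space)
    also have "ennreal \<dots> \<le> ennreal (p\<^sup>2 * \<eta> + y\<^sup>2)"
      using I(4) by (intro ennreal_leI add_right_mono mult_left_mono) auto
    also have "\<dots> = ennreal (p\<^sup>2 * \<eta>) + ennreal (y\<^sup>2)"
      using \<open>0 \<le> \<eta>\<close> by (intro ennreal_plus) auto
    finally show ?thesis .
  qed
  have "(\<integral>\<^sup>+x. ennreal ((p * fst x + q * snd x t)\<^sup>2) \<partial>(\<nu> \<Otimes>\<^sub>M PiM I \<rho>))
     = (\<integral>\<^sup>+g. \<integral>\<^sup>+a. ennreal ((p * a + q * g t)\<^sup>2) \<partial>\<nu> \<partial>PiM I \<rho>)"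
    by (subst P.nn_integral_snd[symmetric]) (simp_all)
  also have "\<dots> \<le> (\<integral>\<^sup>+g. ennreal (p\<^sup>2 * \<eta>) + ennreal ((q * g t)\<^sup>2) \<partial>PiM I \<rho>)"
    by (intro nn_integral_mono inner)
  also have "\<dots> = ennreal (p\<^sup>2 * \<eta>) + (\<integral>\<^sup>+g. ennreal (q\<^sup>2) * ennreal ((g t)\<^sup>2) \<partial>PiM I \<rho>)"
    by (subst nn_integral_add) (simp_all add: Q.emeasure_space_1 power_mult_distrib ennreal_mult)
  also have "(\<integral>\<^sup>+g. ennreal (q\<^sup>2) * ennreal ((g t)\<^sup>2) \<partial>PiM I \<rho>) = ennreal (q\<^sup>2) * (\<integral>\<^sup>+g. ennreal ((g t)\<^sup>2) \<partial>PiM I \<rho>)"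
    by (rule nn_integral_cmult) measurable
  also have "(\<integral>\<^sup>+g. ennreal ((g t)\<^sup>2) \<partial>PiM I \<rho>) = (\<integral>\<^sup>+x. ennreal (x\<^sup>2) \<partial>distr (PiM I \<rho>) (\<rho> t) (\<lambda>g. g t))"
    using sq by (intro nn_integral_distr[OF measurable_component_singleton[OF t], symmetric]) simp
  also have "distr (PiM I \<rho>) (\<rho> t) (\<lambda>g. g t) = \<rho> t"
    using t by (intro distr_PiM_component prob)
  also have "ennreal (p\<^sup>2 * \<eta>) + ennreal (q\<^sup>2) * (\<integral>\<^sup>+x. ennreal (x\<^sup>2) \<partial>\<rho> t)
     \<le> ennreal (p\<^sup>2 * \<eta>) + ennreal (q\<^sup>2) * ennreal v"
    using v by (intro add_left_mono mult_left_mono) auto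
  also have "\<dots> = ennreal (p\<^sup>2 * \<eta> + q\<^sup>2 * v)"
    using \<open>0 \<le> \<eta>\<close> v by (simp add: ennreal_mult[symmetric] ennreal_plus[symmetric] del: ennreal_plus)
  finally show ?thesis .
qed


text \<open>The weighted square inequality separates the product of the Wiener errors from the
  residual sum, and Cauchy-Schwarz splits that sum. By independence each expected product becomes a
  product of second moments, bounded uniformly in the input laws.\<close>

lemma LMSE_noise_law_le:
  fixes N M T :: nat
  assumes prob: "\<And>t. prob_space (\<rho> t)" and sets: "\<And>t. sets (\<rho> t) = sets borel"
    and var: "\<And>t. (\<integral>\<^sup>+x. ennreal (x\<^sup>2) \<partial>\<rho> t) \<le> ennreal C" "0 \<le> C"
    and varT: "(\<integral>\<^sup>+x. ennreal (x\<^sup>2) \<partial>\<rho> T) \<le> ennreal v" "0 \<le> v"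
    and T: "0 < T" and \<eta>: "0 \<le> \<eta>" and s: "0 < s"
  defines "F \<equiv> Pi\<^sub>E {..<M} (\<lambda>_. {..T})"
  shows "LMSE N M \<eta> (\<lambda>_. noise_law N T \<delta> \<rho>) d \<le>
    ennreal ((1 + s) * (c\<^sup>2 * \<eta> + (1 - c)\<^sup>2 * v) ^ M +
      (1 + 1 / s) * real (card F) * (\<Sum>f\<in>F. (residual_coeff N M T c \<delta> d f)\<^sup>2) * (\<eta> + C) ^ M)"
  unfolding LMSE_def
proof (rule SUP_least)
  fix \<nu> assume "\<nu> \<in> {\<nu>. \<forall>i<M. is_input_law \<eta> (\<nu> i)}"
  then have \<nu>: "is_input_law \<eta> (\<nu> i)" if "i < M" for i using that by simp
  let ?Q = "PiM {1..T} \<rho>" and ?\<mu> = "noise_law N T \<delta> \<rho>" and ?\<kappa> = "residual_coeff N M T c \<delta> d"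
  let ?P = "PiM {..<M} (\<lambda>i. \<nu> i \<Otimes>\<^sub>M ?Q)"
  interpret Q: prob_space ?Q by (intro prob_space_PiM prob)
  note meas = node_noise_measurable'[OF sets]
  interpret \<mu>: prob_space ?\<mu> unfolding noise_law_def by (rule Q.prob_space_distr[OF meas])
  have finF: "finite F" unfolding F_def by (intro finite_PiE) auto
  note sets[measurable_cong]
  have sets\<mu>[measurable_cong]: "sets ?\<mu> = sets (PiM {..<N} (\<lambda>_. borel))" by (simp add: noise_law_def)
  have [measurable_cong]: "sets ?Q = sets (PiM {1..T} (\<lambda>_. borel))" by (rule sets_PiM_borel) (rule sets)
  have \<nu>sets: "sets (\<nu> i) = sets borel" if "i < M" for i using \<nu>[OF that] by (simp add: is_input_law_def)
  have probQ: "prob_space (\<nu> i \<Otimes>\<^sub>M ?Q)" and prob\<mu>: "prob_space (\<nu> i \<Otimes>\<^sub>M ?\<mu>)" if "i < M" for i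
  proof -
    interpret nu: prob_space "\<nu> i" using \<nu>[OF that] by (simp add: is_input_law_def)
    interpret pair_prob_space "\<nu> i" ?Q ..
    show "prob_space (\<nu> i \<Otimes>\<^sub>M ?Q)" by unfold_locales
    interpret mu: pair_prob_space "\<nu> i" ?\<mu> ..
    show "prob_space (\<nu> i \<Otimes>\<^sub>M ?\<mu>)" by unfold_locales
  qed
  \<comment> \<open>\<open>\<phi>\<close> replaces the independent noises by the stored ones.
    Pulling back along it moves the expectation to the space of the independent noises.\<close>
  define \<phi> where "\<phi> = (\<lambda>x::real \<times> (nat \<Rightarrow> real). (fst x, \<lambda>j\<in>{..<N}. node_noise T \<delta> (snd x) j))"
  have \<phi>[measurable]: "\<phi> \<in> \<nu> i \<Otimes>\<^sub>M ?Q \<rightarrow>\<^sub>M \<nu> i \<Otimes>\<^sub>M ?\<mu>" if "i < M" for i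
  proof -
    have "(\<lambda>x. \<lambda>j\<in>{..<N}. node_noise T \<delta> (snd x) j) \<in> \<nu> i \<Otimes>\<^sub>M ?Q \<rightarrow>\<^sub>M ?\<mu>"
      unfolding measurable_cong_sets[OF refl sets\<mu>] by (rule measurable_compose[OF measurable_snd meas])
    then show ?thesis unfolding \<phi>_def by (intro measurable_Pair measurable_fst)
  qed
  have distr: "distr (\<nu> i \<Otimes>\<^sub>M ?Q) (\<nu> i \<Otimes>\<^sub>M ?\<mu>) \<phi> = \<nu> i \<Otimes>\<^sub>M ?\<mu>" if "i < M" for i
  proof -
    have "distr (\<nu> i) (\<nu> i) (\<lambda>x. x) \<Otimes>\<^sub>M distr ?Q (PiM {..<N} (\<lambda>_. borel)) (\<lambda>g. \<lambda>j\<in>{..<N}. node_noise T \<delta> g j)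
       = distr (\<nu> i \<Otimes>\<^sub>M ?Q) (\<nu> i \<Otimes>\<^sub>M PiM {..<N} (\<lambda>_. borel)) (\<lambda>(x, g). (x, \<lambda>j\<in>{..<N}. node_noise T \<delta> g j))"
      using meas \<mu>.sigma_finite_measure_axioms unfolding noise_law_def by (intro pair_measure_distr) auto
    also have "\<dots> = distr (\<nu> i \<Otimes>\<^sub>M ?Q) (\<nu> i \<Otimes>\<^sub>M ?\<mu>) \<phi>"
      by (intro distr_cong) (auto simp: \<phi>_def sets\<mu> intro: sets_pair_measure_cong)
    finally show ?thesis by (simp add: noise_law_def distr_id2)
  qed
  have PiM_eq: "PiM {..<M} (\<lambda>i. \<nu> i \<Otimes>\<^sub>M ?\<mu>) = distr ?P (PiM {..<M} (\<lambda>i. \<nu> i \<Otimes>\<^sub>M ?\<mu>)) (compose {..<M} \<phi>)"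
  proof -
    have "distr ?P (PiM {..<M} (\<lambda>i. \<nu> i \<Otimes>\<^sub>M ?\<mu>)) (compose {..<M} \<phi>)
       = PiM {..<M} (\<lambda>i. distr (\<nu> i \<Otimes>\<^sub>M ?Q) (\<nu> i \<Otimes>\<^sub>M ?\<mu>) \<phi>)"
      using probQ prob\<mu> \<phi> by (intro distr_PiM_finite_prob_space') auto
    also have "\<dots> = PiM {..<M} (\<lambda>i. \<nu> i \<Otimes>\<^sub>M ?\<mu>)"
      using distr by (intro PiM_cong) auto
    finally show ?thesis by simp
  qed
  have comp_meas: "compose {..<M} \<phi> \<in> ?P \<rightarrow>\<^sub>M PiM {..<M} (\<lambda>i. \<nu> i \<Otimes>\<^sub>M ?\<mu>)"
    unfolding compose_def by (intro measurable_restrict measurable_PiM_component_rev \<phi>) auto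
  have err_meas: "(\<lambda>\<omega>. ennreal (scheme_err N M d \<omega>)) \<in> borel_measurable (PiM {..<M} (\<lambda>i. \<nu> i \<Otimes>\<^sub>M ?\<mu>))"
  proof -
    have "(\<lambda>\<omega>. fst (\<omega> i)) \<in> borel_measurable (PiM {..<M} (\<lambda>i. \<nu> i \<Otimes>\<^sub>M ?\<mu>))" if "i < M" for i
    proof -
      have "fst \<in> borel_measurable (\<nu> i \<Otimes>\<^sub>M ?\<mu>)"
        using measurable_fst[of "\<nu> i" ?\<mu>] measurable_cong_sets[OF refl \<nu>sets[OF that]] by blast
      then show ?thesis using that by (intro measurable_PiM_component_rev) auto
    qed
    moreover have "(\<lambda>\<omega>. snd (\<omega> i) j) \<in> borel_measurable (PiM {..<M} (\<lambda>i. \<nu> i \<Otimes>\<^sub>M ?\<mu>))" if "i < M" "j < N" for i j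
    proof -
      have "(\<lambda>r. r j) \<in> borel_measurable ?\<mu>"
        unfolding measurable_cong_sets[OF sets\<mu> refl] using that by simp
      then have "(\<lambda>x. snd x j) \<in> borel_measurable (\<nu> i \<Otimes>\<^sub>M ?\<mu>)"
        by (rule measurable_compose[OF measurable_snd])
      then show ?thesis using that by (intro measurable_PiM_component_rev[where f="\<lambda>x. snd x j"]) auto
    qed
    ultimately show ?thesis
      unfolding scheme_err_def
      by (intro measurable_compose[OF _ measurable_ennreal] borel_measurable_power borel_measurable_abs
          borel_measurable_diff borel_measurable_sum borel_measurable_times borel_measurable_prod
          borel_measurable_add borel_measurable_const) auto
  qed
  have lin: "(\<lambda>x. ennreal ((p * fst x + q * snd x t)\<^sup>2)) \<in> borel_measurable (\<nu> i \<Otimes>\<^sub>M ?Q)"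
    if "i < M" "t \<in> {1..T}" for i t p q
  proof -
    have [measurable]: "fst \<in> borel_measurable (\<nu> i \<Otimes>\<^sub>M ?Q)"
      using measurable_fst[of "\<nu> i" ?Q] measurable_cong_sets[OF refl \<nu>sets[OF that(1)]] by blast
    have "(\<lambda>g. g t) \<in> borel_measurable ?Q"
      using that by measurable
    then have [measurable]: "(\<lambda>x. snd x t) \<in> borel_measurable (\<nu> i \<Otimes>\<^sub>M ?Q)"
      by (rule measurable_compose[OF measurable_snd])
    show ?thesis by measurable
  qed
  define W where "W = (\<lambda>x. c * fst x + (- (1 - c)) * snd x T :: real)"
  have Wmeas: "(\<lambda>x. ennreal ((W x)\<^sup>2)) \<in> borel_measurable (\<nu> i \<Otimes>\<^sub>M ?Q)"
    and Wint: "(\<integral>\<^sup>+x. ennreal ((W x)\<^sup>2) \<partial>(\<nu> i \<Otimes>\<^sub>M ?Q)) \<le> ennreal (c\<^sup>2 * \<eta> + (1 - c)\<^sup>2 * v)" if "i < M" for i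
  proof -
    have "T \<in> {1..T}" using T by simp
    from lin[OF that this, of c "- (1 - c)"]
      nn_integral_square_input_noise_le[where \<rho>=\<rho> and t=T, OF \<nu>[OF that] prob sets this varT, of c "- (1 - c)"]
    show "(\<lambda>x. ennreal ((W x)\<^sup>2)) \<in> borel_measurable (\<nu> i \<Otimes>\<^sub>M ?Q)"
      "(\<integral>\<^sup>+x. ennreal ((W x)\<^sup>2) \<partial>(\<nu> i \<Otimes>\<^sub>M ?Q)) \<le> ennreal (c\<^sup>2 * \<eta> + (1 - c)\<^sup>2 * v)"
      unfolding W_def power2_minus by auto
  qed
  have Ymeas: "(\<lambda>x. ennreal ((layer T x t)\<^sup>2)) \<in> borel_measurable (\<nu> i \<Otimes>\<^sub>M ?Q)"
    and Yint: "(\<integral>\<^sup>+x. ennreal ((layer T x t)\<^sup>2) \<partial>(\<nu> i \<Otimes>\<^sub>M ?Q)) \<le> ennreal (\<eta> + C)" if "i < M" "t \<le> T" for i t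
  proof -
    \<comment> \<open>Layer 0 contains the main noise, whose index is \<open>T\<close>; thus each
      layer is \<open>p\<close> times the input plus a single noise.\<close>
    define t' where "t' = (if t = 0 then T else t)"
    define p :: real where "p = (if t = 0 then 1 else 0)"
    have t': "t' \<in> {1..T}" using that T by (auto simp: t'_def)
    have eq: "layer T x t = p * fst x + 1 * snd x t'" for x by (simp add: layer_def p_def t'_def)
    show "(\<lambda>x. ennreal ((layer T x t)\<^sup>2)) \<in> borel_measurable (\<nu> i \<Otimes>\<^sub>M ?Q)"
      unfolding eq by (rule lin[OF that(1) t'])
    have "(\<integral>\<^sup>+x. ennreal ((layer T x t)\<^sup>2) \<partial>(\<nu> i \<Otimes>\<^sub>M ?Q)) \<le> ennreal (p\<^sup>2 * \<eta> + 1\<^sup>2 * C)"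
      unfolding eq by (rule nn_integral_square_input_noise_le[where \<rho>=\<rho> and t=t', OF \<nu>[OF that(1)] prob sets t' var])
    also have "\<dots> \<le> ennreal (\<eta> + C)" using \<eta> by (intro ennreal_leI) (auto simp: p_def)
    finally show "(\<integral>\<^sup>+x. ennreal ((layer T x t)\<^sup>2) \<partial>(\<nu> i \<Otimes>\<^sub>M ?Q)) \<le> ennreal (\<eta> + C)" .
  qed
  have prod_le: "(\<lambda>x. \<Prod>i<M. ennreal ((g i (x i))\<^sup>2)) \<in> borel_measurable ?P"
      "(\<integral>\<^sup>+x. (\<Prod>i<M. ennreal ((g i (x i))\<^sup>2)) \<partial>?P) \<le> ennreal (b ^ M)"
    if g: "\<And>i. i < M \<Longrightarrow> (\<lambda>x. ennreal ((g i x)\<^sup>2)) \<in> borel_measurable (\<nu> i \<Otimes>\<^sub>M ?Q)"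
      "\<And>i. i < M \<Longrightarrow> (\<integral>\<^sup>+x. ennreal ((g i x)\<^sup>2) \<partial>(\<nu> i \<Otimes>\<^sub>M ?Q)) \<le> ennreal b" and b: "0 \<le> b"
    for g :: "nat \<Rightarrow> real \<times> (nat \<Rightarrow> real) \<Rightarrow> real" and b
  proof -
    show "(\<lambda>x. \<Prod>i<M. ennreal ((g i (x i))\<^sup>2)) \<in> borel_measurable ?P"
    proof (intro borel_measurable_prod_ennreal)
      fix i assume "i \<in> {..<M}"
      then show "(\<lambda>x. ennreal ((g i (x i))\<^sup>2)) \<in> borel_measurable ?P"
        using g(1)[of i] by (intro measurable_PiM_component_rev[where f="\<lambda>x. ennreal ((g i x)\<^sup>2)"]) auto
    qed
    \<comment> \<open>\<open>product_prob_space\<close> asks for a probability measure at every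
      index; a point mass fills the indices from \<open>M\<close> on.\<close>
    define R where "R = (\<lambda>i. if i < M then \<nu> i \<Otimes>\<^sub>M ?Q else return borel undefined)"
    interpret R: product_prob_space R
      by (rule product_prob_spaceI) (use probQ in \<open>auto simp: R_def intro: prob_space_return\<close>)
    have "?P = PiM {..<M} R" by (intro PiM_cong) (auto simp: R_def)
    then have "(\<integral>\<^sup>+x. (\<Prod>i<M. ennreal ((g i (x i))\<^sup>2)) \<partial>?P) = (\<Prod>i<M. \<integral>\<^sup>+x. ennreal ((g i x)\<^sup>2) \<partial>R i)"
      using g(1) by (simp only:) (intro R.product_nn_integral_prod, auto simp: R_def)
    also have "\<dots> \<le> (\<Prod>i<M. ennreal b)"
      using g(2) by (intro prod_mono_ennreal) (auto simp: R_def)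
    also have "\<dots> = ennreal (b ^ M)" using b by (simp add: ennreal_power)
    finally show "(\<integral>\<^sup>+x. (\<Prod>i<M. ennreal ((g i (x i))\<^sup>2)) \<partial>?P) \<le> ennreal (b ^ M)" .
  qed
  define b where "b = c\<^sup>2 * \<eta> + (1 - c)\<^sup>2 * v"
  have b: "0 \<le> b" using \<eta> varT by (simp add: b_def)
  define k where "k = (1 + 1 / s) * real (card F)"
  have k: "0 \<le> k" using s by (simp add: k_def)
  have C: "0 \<le> \<eta> + C" using \<eta> var by simp
  have point: "ennreal (scheme_err N M d (compose {..<M} \<phi> x))
     \<le> ennreal (1 + s) * (\<Prod>i<M. ennreal ((W (x i))\<^sup>2)) +
       (\<Sum>f\<in>F. ennreal (k * (?\<kappa> f)\<^sup>2) * (\<Prod>i<M. ennreal ((layer T (x i) (f i))\<^sup>2)))" for x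
  proof -
    let ?Z = "\<Sum>f\<in>F. ?\<kappa> f * (\<Prod>i<M. layer T (x i) (f i))"
    have "scheme_err N M d (compose {..<M} \<phi> x)
       = ((\<Sum>j<N. d j * (\<Prod>i<M. fst (x i) + node_noise T \<delta> (snd (x i)) j)) - (\<Prod>i<M. fst (x i)))\<^sup>2"
      by (simp add: scheme_err_def compose_def \<phi>_def)
    also have "\<dots> = (?Z - (\<Prod>i<M. W (x i)))\<^sup>2"
      unfolding decoding_error_expansion[OF T, where c=c] F_def W_def by (simp only: diff_conv_add_uminus mult_minus_left)
    also have "\<dots> \<le> (1 + s) * (\<Prod>i<M. W (x i))\<^sup>2 + (1 + 1 / s) * ?Z\<^sup>2"
      by (rule power2_diff_le_weighted[OF s])
    \<comment> \<open>Cauchy-Schwarz against the constant 1.\<close>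
    also have "?Z\<^sup>2 \<le> (\<Sum>f\<in>F. (?\<kappa> f * (\<Prod>i<M. layer T (x i) (f i)))\<^sup>2) * real (card F)"
      by (rule sum_squared_le_sum_of_squares)
    also have "(1 + 1 / s) * \<dots> = (\<Sum>f\<in>F. (k * (?\<kappa> f)\<^sup>2) * (\<Prod>i<M. (layer T (x i) (f i))\<^sup>2))"
      by (simp add: k_def sum_distrib_left sum_distrib_right power_mult_distrib prod_power_distrib mult_ac)
    finally have "scheme_err N M d (compose {..<M} \<phi> x) \<le> (1 + s) * (\<Prod>i<M. (W (x i))\<^sup>2) +
        (\<Sum>f\<in>F. (k * (?\<kappa> f)\<^sup>2) * (\<Prod>i<M. (layer T (x i) (f i))\<^sup>2))"
      using s by (simp add: prod_power_distrib mult_left_mono)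
    then have "ennreal (scheme_err N M d (compose {..<M} \<phi> x)) \<le> ennreal ((1 + s) * (\<Prod>i<M. (W (x i))\<^sup>2) +
        (\<Sum>f\<in>F. (k * (?\<kappa> f)\<^sup>2) * (\<Prod>i<M. (layer T (x i) (f i))\<^sup>2)))"
      by (rule ennreal_leI)
    also have "\<dots> = ennreal (1 + s) * (\<Prod>i<M. ennreal ((W (x i))\<^sup>2)) +
       (\<Sum>f\<in>F. ennreal (k * (?\<kappa> f)\<^sup>2) * (\<Prod>i<M. ennreal ((layer T (x i) (f i))\<^sup>2)))"
    proof -
      have prod_eq: "(\<Prod>i<M. ennreal ((h i)\<^sup>2)) = ennreal (\<Prod>i<M. (h i)\<^sup>2)" for h :: "nat \<Rightarrow> real"
        by (simp add: prod_ennreal)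
      have nonneg: "0 \<le> (\<Prod>i<M. (h i)\<^sup>2)" for h :: "nat \<Rightarrow> real"
        by (simp add: prod_nonneg)
      have "ennreal (1 + s) * ennreal (\<Prod>i<M. (W (x i))\<^sup>2) = ennreal ((1 + s) * (\<Prod>i<M. (W (x i))\<^sup>2))"
        using s nonneg by (intro ennreal_mult[symmetric]) auto
      moreover have "(\<Sum>f\<in>F. ennreal (k * (?\<kappa> f)\<^sup>2) * ennreal (\<Prod>i<M. (layer T (x i) (f i))\<^sup>2))
         = (\<Sum>f\<in>F. ennreal ((k * (?\<kappa> f)\<^sup>2) * (\<Prod>i<M. (layer T (x i) (f i))\<^sup>2)))"
        using k nonneg by (intro sum.cong ennreal_mult[symmetric]) auto
      moreover have "\<dots> = ennreal (\<Sum>f\<in>F. (k * (?\<kappa> f)\<^sup>2) * (\<Prod>i<M. (layer T (x i) (f i))\<^sup>2))"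
        using k nonneg by (intro sum_ennreal mult_nonneg_nonneg) auto
      ultimately show ?thesis
        using s k nonneg by (simp only: prod_eq)
          (intro ennreal_plus mult_nonneg_nonneg sum_nonneg, auto)
    qed
    finally show ?thesis .
  qed
  have "(\<integral>\<^sup>+\<omega>. ennreal (scheme_err N M d \<omega>) \<partial>PiM {..<M} (\<lambda>i. \<nu> i \<Otimes>\<^sub>M ?\<mu>))
     = (\<integral>\<^sup>+x. ennreal (scheme_err N M d (compose {..<M} \<phi> x)) \<partial>?P)"
    by (subst PiM_eq, rule nn_integral_distr[OF comp_meas]) (simp add: err_meas)
  also have "\<dots> \<le> (\<integral>\<^sup>+x. ennreal (1 + s) * (\<Prod>i<M. ennreal ((W (x i))\<^sup>2)) +
       (\<Sum>f\<in>F. ennreal (k * (?\<kappa> f)\<^sup>2) * (\<Prod>i<M. ennreal ((layer T (x i) (f i))\<^sup>2))) \<partial>?P)"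
    by (intro nn_integral_mono point)
  also have "\<dots> = ennreal (1 + s) * (\<integral>\<^sup>+x. (\<Prod>i<M. ennreal ((W (x i))\<^sup>2)) \<partial>?P) +
       (\<Sum>f\<in>F. ennreal (k * (?\<kappa> f)\<^sup>2) * (\<integral>\<^sup>+x. (\<Prod>i<M. ennreal ((layer T (x i) (f i))\<^sup>2)) \<partial>?P))"
  proof -
    have mW: "(\<lambda>x. \<Prod>i<M. ennreal ((W (x i))\<^sup>2)) \<in> borel_measurable ?P"
      using Wmeas Wint b unfolding b_def[symmetric] by (rule prod_le(1)[of "\<lambda>_. W" b])
    have mY: "(\<lambda>x. \<Prod>i<M. ennreal ((layer T (x i) (f i))\<^sup>2)) \<in> borel_measurable ?P" if "f \<in> F" for f
      using that C by (intro prod_le(1)[of "\<lambda>i x. layer T x (f i)" "\<eta> + C"] Ymeas Yint) (auto simp: F_def PiE_def)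
    show ?thesis
      using mW mY by (subst nn_integral_add) (auto simp: nn_integral_cmult nn_integral_sum intro!: borel_measurable_sum)
  qed
  also have "\<dots> \<le> ennreal (1 + s) * ennreal (b ^ M) + (\<Sum>f\<in>F. ennreal (k * (?\<kappa> f)\<^sup>2) * ennreal ((\<eta> + C) ^ M))"
  proof (intro add_mono mult_left_mono sum_mono)
    show "(\<integral>\<^sup>+x. (\<Prod>i<M. ennreal ((W (x i))\<^sup>2)) \<partial>?P) \<le> ennreal (b ^ M)"
      using Wmeas Wint b unfolding b_def[symmetric] by (rule prod_le(2)[of "\<lambda>_. W" b])
    fix f assume "f \<in> F"
    then show "(\<integral>\<^sup>+x. (\<Prod>i<M. ennreal ((layer T (x i) (f i))\<^sup>2)) \<partial>?P) \<le> ennreal ((\<eta> + C) ^ M)"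
      using C by (intro prod_le(2)[of "\<lambda>i x. layer T x (f i)"] Ymeas Yint) (auto simp: F_def PiE_def)
  qed auto
  also have "\<dots> = ennreal ((1 + s) * b ^ M + (\<Sum>f\<in>F. k * (?\<kappa> f)\<^sup>2 * (\<eta> + C) ^ M))"
  proof -
    have "(\<Sum>f\<in>F. ennreal (k * (?\<kappa> f)\<^sup>2) * ennreal ((\<eta> + C) ^ M)) = ennreal (\<Sum>f\<in>F. k * (?\<kappa> f)\<^sup>2 * (\<eta> + C) ^ M)"
      using k C by (simp add: ennreal_mult[symmetric])
    moreover have "ennreal (1 + s) * ennreal (b ^ M) = ennreal ((1 + s) * b ^ M)"
      using s b by (intro ennreal_mult[symmetric]) auto
    ultimately show ?thesis
      using s b k C by (simp only:) (intro ennreal_plus[symmetric], auto intro!: sum_nonneg)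
  qed
  also have "(\<Sum>f\<in>F. k * (?\<kappa> f)\<^sup>2 * (\<eta> + C) ^ M) = k * (\<Sum>f\<in>F. (?\<kappa> f)\<^sup>2) * (\<eta> + C) ^ M"
    by (simp add: sum_distrib_left sum_distrib_right)
  finally show "(\<integral>\<^sup>+\<omega>. ennreal (scheme_err N M d \<omega>) \<partial>PiM {..<M} (\<lambda>i. \<nu> i \<Otimes>\<^sub>M ?\<mu>))
     \<le> ennreal ((1 + s) * (c\<^sup>2 * \<eta> + (1 - c)\<^sup>2 * v) ^ M +
      (1 + 1 / s) * real (card F) * (\<Sum>f\<in>F. (?\<kappa> f)\<^sup>2) * (\<eta> + C) ^ M)"
    by (simp add: b_def k_def)
qed

section \<open>Choice of the parameters\<close>

theorem theorem1:
  fixes N T M :: nat and \<eta> \<epsilon> \<xi> :: real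
  assumes "0 < N" "0 < T" "0 < M"
    and "(M - 1) * T + 1 \<le> N" "N \<le> M * T"
    and "\<eta> > 0" "\<epsilon> > 0" "\<xi> > 0"
  shows "\<exists>(\<mu> :: nat \<Rightarrow> (nat \<Rightarrow> real) measure) (d :: nat \<Rightarrow> real).
           (\<forall>i<M. is_noise_law N (\<mu> i) \<and> node_DP N T \<epsilon> (\<mu> i)) \<and>
           LMSE N M \<eta> \<mu> d \<le> ennreal (\<eta>^M / (1 + SNR_star \<eta> \<epsilon>)^M + \<xi>)"
proof -
  define \<sigma> where "\<sigma> = sigma_star_sq \<epsilon>"
  obtain \<epsilon>' where \<epsilon>': "0 < \<epsilon>'" "\<epsilon>' < \<epsilon>" "staircase_var (exp (- \<epsilon>' / 3)) < \<sigma>"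
    using ex_staircase_var_less_sigma_star_sq[OF \<open>\<epsilon> > 0\<close>] by (auto simp: \<sigma>_def)
  have "0 \<le> staircase_var (exp (- \<epsilon>' / 3))" by (simp add: staircase_var_def)
  then have \<sigma>: "0 < \<sigma>" using \<epsilon>' by linarith
  obtain \<rho>1 where \<rho>1: "dp_noise \<epsilon>' (staircase_var (exp (- \<epsilon>' / 3))) \<rho>1"
    using ex_dp_noise[OF \<epsilon>'(1)] by blast
  \<comment> \<open>The saved budget in \<open>T\<close> equal shares, enough for the
    \<open>T - 1\<close> auxiliary noises.\<close>
  define \<epsilon>2 where "\<epsilon>2 = (\<epsilon> - \<epsilon>') / real T"
  have "0 < \<epsilon>2" using \<epsilon>' assms by (simp add: \<epsilon>2_def)
  then obtain \<rho>2 where \<rho>2: "dp_noise \<epsilon>2 (staircase_var (exp (- \<epsilon>2 / 3))) \<rho>2"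
    using ex_dp_noise by blast
  define \<rho> where "\<rho> = (\<lambda>t. if t = T then \<rho>1 else \<rho>2)"
  define e where "e = (\<lambda>t. if t = T then \<epsilon>' else \<epsilon>2)"
  define C where "C = max \<sigma> (staircase_var (exp (- \<epsilon>2 / 3)))"
  have C: "0 \<le> C" using \<sigma> by (simp add: C_def)
  have prob: "prob_space (\<rho> t)" and sets: "sets (\<rho> t) = sets borel"
    and int: "integrable (\<rho> t) (\<lambda>x. x)" and mean: "(\<integral>x. x \<partial>\<rho> t) = 0" and DP: "shift_DP (e t) (\<rho> t)" for t
    using \<rho>1 \<rho>2 by (auto simp: dp_noise_def \<rho>_def e_def)
  have varT: "(\<integral>\<^sup>+x. ennreal (x\<^sup>2) \<partial>\<rho> T) \<le> ennreal \<sigma>"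
    using \<rho>1 order_trans[OF _ ennreal_leI[OF less_imp_le[OF \<epsilon>'(3)]]] by (auto simp: dp_noise_def \<rho>_def)
  have var: "(\<integral>\<^sup>+x. ennreal (x\<^sup>2) \<partial>\<rho> t) \<le> ennreal C" for t
  proof (cases "t = T")
    case True
    then show ?thesis using order_trans[OF varT ennreal_leI[of \<sigma> C]] by (simp add: C_def)
  next
    case False
    then show ?thesis
      using \<rho>2 order_trans[OF _ ennreal_leI[of "staircase_var (exp (- \<epsilon>2 / 3))" C]]
      by (auto simp: dp_noise_def \<rho>_def C_def)
  qed
  have e: "(\<Sum>t\<in>{1..T}. e t) \<le> \<epsilon>"
  proof -
    have "{1..T} = insert T {1..<T}" using assms by auto
    then have "(\<Sum>t\<in>{1..T}. e t) = \<epsilon>' + real (T - 1) * \<epsilon>2"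
      by (simp add: e_def)
    also have "\<dots> \<le> \<epsilon>' + real T * \<epsilon>2" using \<open>0 < \<epsilon>2\<close> by (intro add_left_mono mult_right_mono) auto
    also have "\<dots> = \<epsilon>" using assms by (simp add: \<epsilon>2_def)
    finally show ?thesis .
  qed
  \<comment> \<open>This is 1 - \<alpha>, the minimiser of
    \<open>c\<^sup>2 * \<eta> + (1 - c)\<^sup>2 * \<sigma>\<close>; the minimum is \<eta> \<sigma> /
    (\<eta> + \<sigma>) = \<eta> / (1 + \<eta> / \<sigma>).\<close>
  define c where "c = \<sigma> / (\<eta> + \<sigma>)"
  define \<Theta> where "\<Theta> = (c\<^sup>2 * \<eta> + (1 - c)\<^sup>2 * \<sigma>) ^ M"
  have \<Theta>: "\<Theta> = \<eta> ^ M / (1 + SNR_star \<eta> \<epsilon>) ^ M" "0 \<le> \<Theta>"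
  proof -
    define r where "r = \<eta> + \<sigma>"
    have r: "0 < r" using \<sigma> assms by (simp add: r_def)
    have "1 - c = \<eta> / r" "c = \<sigma> / r" using r by (auto simp: c_def r_def field_simps)
    then have "c\<^sup>2 * \<eta> + (1 - c)\<^sup>2 * \<sigma> = \<eta> * \<sigma> * (\<sigma> + \<eta>) / (r * r)"
      by (simp add: power2_eq_square add_divide_distrib distrib_left mult_ac)
    also have "\<dots> = \<eta> * \<sigma> / r" using r by (simp add: r_def add.commute)
    also have "\<dots> = \<eta> / (1 + SNR_star \<eta> \<epsilon>)"
      using \<sigma> r by (simp add: SNR_star_def \<sigma>_def[symmetric] r_def field_simps)
    finally show "\<Theta> = \<eta> ^ M / (1 + SNR_star \<eta> \<epsilon>) ^ M" by (simp add: \<Theta>_def power_divide)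
    show "0 \<le> \<Theta>" using \<sigma> assms by (simp add: \<Theta>_def)
  qed
  \<comment> \<open>Half of \<xi> covers the excess \<open>s * \<Theta>\<close>, the other half the
    residual part. Adding 1 to \<Theta> keeps the denominator positive.\<close>
  define s where "s = \<xi> / (2 * (\<Theta> + 1))"
  have s: "0 < s" using assms \<Theta> by (simp add: s_def)
  have "s * \<Theta> \<le> s * (\<Theta> + 1)" using s by (intro mult_left_mono) auto
  also have "\<dots> = \<xi> / 2" using \<Theta>(2) by (simp add: s_def field_simps)
  finally have s\<Theta>: "s * \<Theta> \<le> \<xi> / 2" .
  define N0 where "N0 = (M - 1) * T + 1"
  have "N0 \<le> N" using assms by (simp add: N0_def)
  have "inj_on node_pt {..<N0}" by (auto simp: inj_on_def node_pt_def)
  then obtain L where L: "\<And>m k. m < N0 \<Longrightarrow> k < N0 \<Longrightarrow>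
      (\<Sum>j<N0. L j m * node_pt j ^ k) = (if k = m then 1 else 0)"
    using ex_inverse_vandermonde[of node_pt N0] by blast
  \<comment> \<open>Only the first \<open>N0\<close> nodes are decoded; the factors
    \<open>1 - c ^ (M - k)\<close> are the target weights up to sign.\<close>
  define d where "d = (\<lambda>\<delta> j. if j < N0 then \<Sum>k<M. L j (k * T) * (1 - c ^ (M - k)) / \<delta> ^ ((T + 1) * k) else 0)"
  define F where "F = Pi\<^sub>E {..<M} (\<lambda>_. {..T})"
  define \<kappa> where "\<kappa> = (\<lambda>\<delta> f. residual_coeff N M T c \<delta> (d \<delta>) f)"
  have \<kappa>: "((\<lambda>\<delta>. \<kappa> \<delta> f) \<longlongrightarrow> 0) (at_right 0)" if "f \<in> F" for f
  proof -
    have "(\<Sum>j<N. d \<delta> j * node_pt j ^ n) = (\<Sum>j<N0. (\<Sum>k<M. L j (k * T) * (1 - c ^ (M - k)) / \<delta> ^ ((T + 1) * k)) * node_pt j ^ n)" for \<delta> n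
      using \<open>N0 \<le> N\<close> by (intro sum.mono_neutral_cong_right) (auto simp: d_def)
    moreover have "f i \<le> T" if "i < M" for i using \<open>f \<in> F\<close> that by (auto simp: F_def PiE_def)
    note lim = decoding_coeff_tendsto[where c=c and z=node_pt and L=L and f=f, OF assms(2,3) L[unfolded N0_def] this]
    ultimately show ?thesis
      unfolding \<kappa>_def residual_coeff_def using lim[folded N0_def] by (simp only: LIM_zero)
  qed
  \<comment> \<open>\<open>s\<close>, \<open>C\<close> and the finite set \<open>F\<close> are fixed
    before \<delta>, so the residual part vanishes with the residual weights.\<close>
  have "((\<lambda>\<delta>. (1 + 1 / s) * real (card F) * (\<Sum>f\<in>F. (\<kappa> \<delta> f)\<^sup>2) * (\<eta> + C) ^ M)
      \<longlongrightarrow> (1 + 1 / s) * real (card F) * (\<Sum>f\<in>F. 0\<^sup>2) * (\<eta> + C) ^ M) (at_right 0)"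
    by (intro tendsto_intros \<kappa>)
  then have "\<forall>\<^sub>F \<delta> in at_right 0. (1 + 1 / s) * real (card F) * (\<Sum>f\<in>F. (\<kappa> \<delta> f)\<^sup>2) * (\<eta> + C) ^ M < \<xi> / 2"
    by (rule order_tendstoD) (use assms in simp)
  \<comment> \<open>There are finitely many \<open>S\<close> and \<open>t\<close>, so one \<delta>
    serves all of them.\<close>
  moreover have "\<forall>\<^sub>F \<delta> in at_right (0::real). \<forall>S\<in>Pow {..<N}. \<forall>t\<in>{..<T}. \<delta> * \<bar>coeff (node_poly S) t\<bar> < 1"
  proof (intro eventually_ball_finite ballI)
    fix S t
    have "((\<lambda>\<delta>::real. \<delta> * \<bar>coeff (node_poly S) t\<bar>) \<longlongrightarrow> 0 * \<bar>coeff (node_poly S) t\<bar>) (at_right 0)"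
      by (intro tendsto_intros)
    then show "\<forall>\<^sub>F \<delta> in at_right (0::real). \<delta> * \<bar>coeff (node_poly S) t\<bar> < 1"
      by (rule order_tendstoD) simp
  qed auto
  moreover have "\<forall>\<^sub>F \<delta> in at_right (0::real). 0 < \<delta>" by (rule eventually_at_right_less)
  ultimately have "\<forall>\<^sub>F \<delta> in at_right (0::real). 0 < \<delta> \<and> (\<forall>S\<in>Pow {..<N}. \<forall>t\<in>{..<T}. \<delta> * \<bar>coeff (node_poly S) t\<bar> < 1) \<and>
      (1 + 1 / s) * real (card F) * (\<Sum>f\<in>F. (\<kappa> \<delta> f)\<^sup>2) * (\<eta> + C) ^ M < \<xi> / 2"
    by eventually_elim simp
  then obtain \<delta> where \<delta>: "0 < \<delta>" "\<forall>S\<in>Pow {..<N}. \<forall>t\<in>{..<T}. \<delta> * \<bar>coeff (node_poly S) t\<bar> < 1"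
      "(1 + 1 / s) * real (card F) * (\<Sum>f\<in>F. (\<kappa> \<delta> f)\<^sup>2) * (\<eta> + C) ^ M < \<xi> / 2"
    using eventually_happens'[OF trivial_limit_at_right_real] by blast
  have "is_noise_law N (noise_law N T \<delta> \<rho>)"
    by (rule is_noise_law_noise_law[OF prob sets int mean])
  moreover have "node_DP N T \<epsilon> (noise_law N T \<delta> \<rho>)"
    by (rule node_DP_noise_law[OF prob sets DP e \<open>0 < T\<close> \<delta>(1)]) (use \<delta>(2) in \<open>auto intro!: less_imp_le\<close>)
  moreover have "LMSE N M \<eta> (\<lambda>_. noise_law N T \<delta> \<rho>) (d \<delta>) \<le> ennreal (\<eta>^M / (1 + SNR_star \<eta> \<epsilon>)^M + \<xi>)"
  proof -
    have "LMSE N M \<eta> (\<lambda>_. noise_law N T \<delta> \<rho>) (d \<delta>) \<le> ennreal ((1 + s) * \<Theta> +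
        (1 + 1 / s) * real (card F) * (\<Sum>f\<in>F. (\<kappa> \<delta> f)\<^sup>2) * (\<eta> + C) ^ M)"
      unfolding \<Theta>_def F_def \<kappa>_def
      by (rule LMSE_noise_law_le[where \<rho>=\<rho> and T=T, OF prob sets var C varT]) (use \<sigma> assms s in auto)
    also have "\<dots> \<le> ennreal (\<Theta> + \<xi>)"
    proof (rule ennreal_leI)
      have "(1 + s) * \<Theta> = \<Theta> + s * \<Theta>" by (simp add: distrib_right)
      then show "(1 + s) * \<Theta> + (1 + 1 / s) * real (card F) * (\<Sum>f\<in>F. (\<kappa> \<delta> f)\<^sup>2) * (\<eta> + C) ^ M \<le> \<Theta> + \<xi>"
        using \<delta>(3) s\<Theta> by linarith
    qed
    finally show ?thesis by (simp only: \<Theta>(1))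
  qed
  ultimately show ?thesis
    by (intro exI[of _ "\<lambda>_. noise_law N T \<delta> \<rho>"] exI[of _ "d \<delta>"]) simp
qed

end
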